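(* Let $Q=T[H_1,\dots,H_t]$ be a strong semicomplete composition with $n$ vertices. Then the smallest strong spanning subdigraph of $Q$ has precisely $n+\epsilon(Q)$ arcs.
   Context: Digraphs are finite, without loops or parallel arcs (2-cycles are allowed); cycles are directed. A digraph is semicomplete if there is at least one arc between every pair of distinct vertices. Let $T$ be a digraph with vertices $u_1,\dots,u_t$ ($t\ge 2$) and let $H_1,\dots,H_t$ be pairwise disjoint nonempty digraphs. The composition $Q=T[H_1,\dots,H_t]$ is the digraph with vertex set $\bigcup_i V(H_i)$ and arc set $\bigcup_{i=1}^t A(H_i)\cup\{xy : x\in V(H_i),\ y\in V(H_p),\ u_iu_p\in A(T)\}$. It is a semicomplete composition if $T$ is semicomplete. A digraph is strong if for every ordered pair of vertices $(x,y)$ there is a directed path from $x$ to $y$. The smallest strong spanning subdigraph of a strong digraph $D$ is a strong spanning subdigraph of $D$ with the fewest arcs. For a digraph $D$ and an integer $k\ge 0$, $H_k(D)$ is the digraph obtained from $D$ by adding $2k$ new vertices $x_1,\dots,x_k,y_1,\dots,y_k$, all arcs from every vertex of $D$ to each $x_i$, all arcs from each $y_i$ to every vertex of $D$, and all arcs $x_iy_j$, $i,j\in\{1,\dots,k\}$ (so $H_0(D)=D$). For a strong digraph $D$, $\epsilon(D)$ is the smallest $k\ge 0$ such that $H_k(D)$ is Hamiltonian, i.e., has a cycle containing all its vertices. *)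

theory Defs
  imports "Graph_Theory.Graph_Theory" "HOL-Library.Disjoint_Sets"
begin

definition semicomplete :: "'a pair_pre_digraph \<Rightarrow> bool" where
  "semicomplete D \<longleftrightarrow>
     (\<forall>u\<in>pverts D. \<forall>v\<in>pverts D. u \<noteq> v \<longrightarrow> (u, v) \<in> parcs D \<or> (v, u) \<in> parcs D)"

text \<open>The digraphs substituted into \<open>T\<close> are indexed by the vertices of \<open>T\<close> themselves:
  \<open>H u\<close> replaces the vertex \<open>u\<close>.\<close>

definition composition ::
  "'b pair_pre_digraph \<Rightarrow> ('b \<Rightarrow> 'a pair_pre_digraph) \<Rightarrow> 'a pair_pre_digraph" where
  "composition T H = \<lparr>
     pverts = (\<Union>u\<in>pverts T. pverts (H u)),
     parcs = (\<Union>u\<in>pverts T. parcs (H u)) \<union>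
       {(x, y) | x y u w. (u, w) \<in> parcs T \<and> x \<in> pverts (H u) \<and> y \<in> pverts (H w)}\<rparr>"

definition smallest_strong_spanning_subdigraph ::
  "('a, 'b) pre_digraph \<Rightarrow> ('a, 'b) pre_digraph \<Rightarrow> bool" where
  "smallest_strong_spanning_subdigraph S D \<longleftrightarrow>
     spanning S D \<and> strongly_connected S \<and>
     (\<forall>S'. spanning S' D \<and> strongly_connected S' \<longrightarrow> card (arcs S) \<le> card (arcs S'))"

text \<open>The argument \<open>u\<close> of \<^const>\<open>pre_digraph.awalk_verts\<close> only matters for the empty walk,
  which is not a cycle.\<close>

definition hamiltonian :: "('a, 'b) pre_digraph \<Rightarrow> bool" where
  "hamiltonian D \<longleftrightarrow>
     (\<exists>u p. pre_digraph.cycle D p \<and> set (pre_digraph.awalk_verts D u p) = verts D)"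

datatype 'a ext_vertex = Old 'a | X nat | Y nat

definition H_ext :: "nat \<Rightarrow> 'a pair_pre_digraph \<Rightarrow> 'a ext_vertex pair_pre_digraph" where
  "H_ext k D = \<lparr>
     pverts = Old ` pverts D \<union> X ` {1..k} \<union> Y ` {1..k},
     parcs = {(Old u, Old v) | u v. (u, v) \<in> parcs D} \<union>
       {(Old v, X i) | v i. v \<in> pverts D \<and> i \<in> {1..k}} \<union>
       {(Y i, Old v) | v i. v \<in> pverts D \<and> i \<in> {1..k}} \<union>
       {(X i, Y j) | i j. i \<in> {1..k} \<and> j \<in> {1..k}}\<rparr>"

text \<open>The minimum exists for every finite nonempty \<open>D\<close>: with \<open>k\<close> the number of vertices
  \<open>v\<^sub>1, \<dots>, v\<^sub>k\<close> of \<open>D\<close>, the closed walk \<open>v\<^sub>1 x\<^sub>1 y\<^sub>1 v\<^sub>2 x\<^sub>2 y\<^sub>2 \<dots> v\<^sub>k x\<^sub>k y\<^sub>k v\<^sub>1\<close> is a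
  Hamiltonian cycle.\<close>

definition epsilon :: "'a pair_pre_digraph \<Rightarrow> nat" where
  "epsilon D = (LEAST k. hamiltonian (with_proj (H_ext k D)))"

end

theory Submission
  imports Defs
begin

text \<open>
  A Hamiltonian cycle of \<open>H\<^sub>k(D)\<close> with \<open>k > 0\<close> is the same as a cover of \<open>D\<close> by \<open>k\<close> disjoint paths.

  Lower bound: a strong digraph is built from a cycle by adding ears, and \<open>j\<close> ears with new vertices
  cost \<open>n + j\<close> arcs in total. If \<open>j > 0\<close>, the cycle followed by its first ear is a path, which together
  with the interiors of the remaining ears gives a cover by \<open>j\<close> paths.

  Upper bound: let \<open>k > 0\<close> paths cover \<open>Q\<close>, and contract their maximal runs inside the parts \<open>H u\<close>.
  Whenever a path visits a part twice, the section in between is split off as a cycle, until each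
  of the \<open>k\<close> paths meets each part at most once. As \<open>T\<close> is strong and semicomplete, all these cycles
  can be merged into a single cycle, which can moreover be enlarged to meet every part. What remains
  of each of the \<open>k\<close> paths consists of pairwise adjacent vertices, so it can be rearranged as a path,
  and this path is an ear on the cycle because the cycle meets every part. The cycle with \<open>k\<close> ears
  has \<open>n + k\<close> arcs.
\<close>

section \<open>Paths and cycles as vertex lists\<close>

text \<open>Arcs inside a part are arbitrary, which is why runs are contracted: afterwards arcs
  depend on the parts alone, and two items of one part are twins, with equal in- and out-neighbours
  and no arc between them. Exchanging twins is what closes a split-off section to a cycle, splices
  two cycles that meet a common part, and attaches an ear at the cycle neighbours of a twin of its
  end. The same fact is the obstacle: twins are not adjacent, so the insertion arguments for
  semicomplete digraphs fail on a list that visits a part twice. Hence the paths are cut before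
  anything is merged. A remnant that meets each part at most once stays pairwise adjacent whichever
  of its vertices the merged cycle takes, so Redei's theorem leaves at most one ear per original
  path and the number k is not exceeded. The lower bound is a fact about all strong digraphs with at
  least two vertices; the composition enters through the upper bound.\<close>

definition dipath :: "'a rel \<Rightarrow> 'a list \<Rightarrow> bool" where
  "dipath A xs \<longleftrightarrow> distinct xs \<and> successively (\<lambda>x y. (x, y) \<in> A) xs"

text \<open>A single vertex counts as a trivial cycle, so that single vertices and proper cycles can be
  absorbed into a larger cycle in the same way.\<close>

definition dicycle :: "'a rel \<Rightarrow> 'a list \<Rightarrow> bool" where
  "dicycle A c \<longleftrightarrow> c \<noteq> [] \<and> dipath A c \<and> (2 \<le> length c \<longrightarrow> (last c, hd c) \<in> A)"

lemma dipath_Nil [simp]: "dipath A []"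
  by (simp add: dipath_def)

lemma dipath_single [simp]: "dipath A [x]"
  by (simp add: dipath_def)

lemma dicycle_single [simp]: "dicycle A [x]"
  by (simp add: dicycle_def)

lemma dipath_append_iff:
  "dipath A (xs @ ys) \<longleftrightarrow> dipath A xs \<and> dipath A ys \<and> set xs \<inter> set ys = {} \<and>
     (xs \<noteq> [] \<longrightarrow> ys \<noteq> [] \<longrightarrow> (last xs, hd ys) \<in> A)"
  by (auto simp: dipath_def successively_append_iff)

lemma dipath_Cons_iff:
  "dipath A (x # xs) \<longleftrightarrow> x \<notin> set xs \<and> dipath A xs \<and> (xs \<noteq> [] \<longrightarrow> (x, hd xs) \<in> A)"
  by (auto simp: dipath_def successively_Cons)

lemma dipath_mono: "dipath A xs \<Longrightarrow> A \<subseteq> B \<Longrightarrow> dipath B xs"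
  by (auto simp: dipath_def intro: successively_mono)

lemma dicycle_imp_dipath: "dicycle A c \<Longrightarrow> dipath A c"
  by (simp add: dicycle_def)

lemma dicycle_rotate:
  assumes "dicycle A (xs @ ys)"
  shows "dicycle A (ys @ xs)"
proof (cases "xs = [] \<or> ys = []")
  case False
  then have "2 \<le> length (xs @ ys)"
    by (cases xs; cases ys) auto
  with assms False show ?thesis
    by (auto simp: dicycle_def dipath_append_iff)
qed (use assms in auto)

lemma dicycle_rotate_hd:
  assumes "dicycle A c" and "x \<in> set c"
  obtains xs where "dicycle A (x # xs)" "set (x # xs) = set c" "length (x # xs) = length c"
proof -
  obtain ys zs where c: "c = ys @ x # zs"
    using assms(2) by (meson split_list)
  show ?thesis
    using dicycle_rotate[of A ys "x # zs"] assms(1) c by (intro that[of "zs @ ys"]) auto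
qed

lemma dicycle_rotate_last:
  assumes "dicycle A c" and "x \<in> set c"
  obtains xs where "dicycle A (xs @ [x])" "set (xs @ [x]) = set c" "length (xs @ [x]) = length c"
proof -
  obtain ys zs where c: "c = ys @ x # zs"
    using assms(2) by (meson split_list)
  show ?thesis
    using dicycle_rotate[of A "ys @ [x]" "zs"] assms(1) c by (intro that[of "zs @ ys"]) auto
qed

lemma dicycle_pred:
  assumes "dicycle A c" and "x \<in> set c" and "2 \<le> length c"
  shows "\<exists>y\<in>set c. (y, x) \<in> A"
proof -
  obtain xs where xs: "dicycle A (x # xs)" "set (x # xs) = set c" "length (x # xs) = length c"
    using dicycle_rotate_hd[OF assms(1,2)] .
  have "(last (x # xs), x) \<in> A"
    using xs(1,3) assms(3) unfolding dicycle_def by (metis list.sel(1))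
  moreover have "last (x # xs) \<in> set c"
    using xs(2) by (metis last_in_set list.distinct(1))
  ultimately show ?thesis by blast
qed

lemma dicycle_succ:
  assumes "dicycle A c" and "x \<in> set c" and "2 \<le> length c"
  shows "\<exists>y\<in>set c. (x, y) \<in> A"
proof -
  obtain xs where xs: "dicycle A (xs @ [x])" "set (xs @ [x]) = set c" "length (xs @ [x]) = length c"
    using dicycle_rotate_last[OF assms(1,2)] .
  have "(x, hd (xs @ [x])) \<in> A"
    using xs(1,3) assms(3) unfolding dicycle_def by (metis last_snoc)
  moreover have "hd (xs @ [x]) \<in> set c"
    using xs(2) by (metis hd_in_set snoc_eq_iff_butlast)
  ultimately show ?thesis by blast
qed

lemma dicycle_append:
  assumes "dicycle A c" and "dipath A r" and "r \<noteq> []" and "set c \<inter> set r = {}"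
    and "(last c, hd r) \<in> A" and "(last r, hd c) \<in> A"
  shows "dicycle A (c @ r)"
  using assms by (auto simp: dicycle_def dipath_append_iff)

section \<open>Absorbing paths into cycles\<close>

text \<open>Start the cycle at an out-neighbour \<open>d\<close> of \<open>r\<close> and let
  \<open>x\<close> be the last vertex with an arc to \<open>r\<close>. The successor of
  \<open>x\<close> either has no arc to \<open>r\<close>, hence receives one from \<open>r\<close>
  by adjacency, or is \<open>d\<close> itself; so \<open>r\<close> fits behind
  \<open>x\<close>.\<close>

lemma dicycle_insert_vertex:
  assumes c: "dicycle A c" and r: "r \<notin> set c"
    and adj: "\<And>x. x \<in> set c \<Longrightarrow> (x, r) \<in> A \<or> (r, x) \<in> A"
    and inn: "\<exists>x\<in>set c. (x, r) \<in> A" and out: "\<exists>x\<in>set c. (r, x) \<in> A"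
  shows "\<exists>c'. dicycle A c' \<and> set c' = insert r (set c)"
proof -
  obtain d where d: "d \<in> set c" "(r, d) \<in> A"
    using out by blast
  obtain xs where xs: "dicycle A (d # xs)" "set (d # xs) = set c"
    using dicycle_rotate_hd[OF c d(1)] by metis
  have "\<exists>x\<in>set (d # xs). (x, r) \<in> A"
    using inn xs(2) by metis
  then obtain ys x zs where split: "d # xs = ys @ x # zs" "(x, r) \<in> A" "\<forall>z\<in>set zs. (z, r) \<notin> A"
    by (rule split_list_last_propE) blast
  have rot: "dicycle A (zs @ ys @ [x])"
    using dicycle_rotate[of A "ys @ [x]" zs] xs(1) split(1) by simp
  have "(r, hd (zs @ ys @ [x])) \<in> A"
  proof (cases zs)
    case Nil
    then show ?thesis using split(1) d(2) by (metis append_Nil list.sel(1))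
  next
    case (Cons z zs')
    have "z \<in> set c" using Cons split(1) xs(2) by (metis in_set_conv_decomp Un_iff list.set_intros(1,2) set_append)
    then show ?thesis using adj[of z] split(3) Cons by auto
  qed
  moreover have "set (zs @ ys @ [x]) = set c"
    using split(1) xs(2) by (metis append.assoc append_Cons append_Nil set_append sup_commute)
  ultimately have "dicycle A ((zs @ ys @ [x]) @ [r])"
    using dicycle_append[OF rot, of "[r]"] split(2) r by auto
  with \<open>set (zs @ ys @ [x]) = set c\<close> show ?thesis
    by (intro exI[of _ "(zs @ ys @ [x]) @ [r]"]) auto
qed

text \<open>If neither end of the path can be inserted on its own, then the whole cycle dominates the
  first vertex and is dominated by the last one, so the path fits into any arc of the cycle.\<close>

lemma dicycle_absorb_path:
  assumes "dicycle A c" and "dipath A r" and "r \<noteq> []" and "set c \<inter> set r = {}"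
    and "\<And>x y. x \<in> set c \<union> set r \<Longrightarrow> y \<in> set r \<Longrightarrow> x \<noteq> y \<Longrightarrow> (x, y) \<in> A \<or> (y, x) \<in> A"
    and "\<exists>x\<in>set c. (x, hd r) \<in> A" and "\<exists>x\<in>set c. (last r, x) \<in> A"
  shows "\<exists>c'. dicycle A c' \<and> set c' = set c \<union> set r"
  using assms
proof (induction "length r" arbitrary: c r rule: less_induct)
  case less
  note adj = less.prems(5)
  show ?case
  proof (cases "\<exists>x\<in>set c. (hd r, x) \<in> A")
    case True
    obtain a s where r: "r = a # s"
      using less.prems(3) by (cases r) auto
    obtain c1 where c1: "dicycle A c1" "set c1 = insert a (set c)"
      using dicycle_insert_vertex[OF less.prems(1), of a] True less.prems(4,6) adj[of _ a] r by fastforce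
    show ?thesis
    proof (cases "s = []")
      case True
      then show ?thesis using c1 r by auto
    next
      case False
      \<comment> \<open>The hypotheses pass to \<open>s\<close>: the arc into its first vertex now
        comes from \<open>a\<close>, which lies on the enlarged cycle.\<close>
      have "\<exists>c'. dicycle A c' \<and> set c' = set c1 \<union> set s"
      proof (rule less.hyps)
        show "length s < length r" "dicycle A c1" "s \<noteq> []"
          using r c1 False by auto
        show "dipath A s" "set c1 \<inter> set s = {}"
          using less.prems(2,4) c1 r by (auto simp: dipath_Cons_iff)
        show "\<exists>x\<in>set c1. (x, hd s) \<in> A"
          using less.prems(2) False r c1 by (auto simp: dipath_Cons_iff)
        show "\<exists>x\<in>set c1. (last s, x) \<in> A"
          using less.prems(7) False r c1 by auto
        show "(x, y) \<in> A \<or> (y, x) \<in> A" if "x \<in> set c1 \<union> set s" "y \<in> set s" "x \<noteq> y" for x y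
          using adj[of x y] that c1 r by auto
      qed
      then show ?thesis using c1 r by auto
    qed
  next
    case no_out: False
    show ?thesis
    proof (cases "\<exists>x\<in>set c. (x, last r) \<in> A")
      case True
      obtain a s where r: "r = s @ [a]"
        using less.prems(3) by (cases r rule: rev_cases) auto
      obtain c1 where c1: "dicycle A c1" "set c1 = insert a (set c)"
        using dicycle_insert_vertex[OF less.prems(1), of a] True less.prems(4,7) adj[of _ a] r by fastforce
      show ?thesis
      proof (cases "s = []")
        case True
        then show ?thesis using c1 r by auto
      next
        case False
        have "\<exists>c'. dicycle A c' \<and> set c' = set c1 \<union> set s"
        proof (rule less.hyps)
          show "length s < length r" "dicycle A c1" "s \<noteq> []"
            using r c1 False by auto
          show "dipath A s" "set c1 \<inter> set s = {}"
            using less.prems(2,4) c1 r by (auto simp: dipath_append_iff)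
          show "\<exists>x\<in>set c1. (x, hd s) \<in> A"
            using less.prems(6) False r c1 by auto
          show "\<exists>x\<in>set c1. (last s, x) \<in> A"
            using less.prems(2) False r c1 by (auto simp: dipath_append_iff)
          show "(x, y) \<in> A \<or> (y, x) \<in> A" if "x \<in> set c1 \<union> set s" "y \<in> set s" "x \<noteq> y" for x y
            using adj[of x y] that c1 r by auto
        qed
        then show ?thesis using c1 r by auto
      qed
    next
      case no_in: False
      have c: "last c \<in> set c" "hd c \<in> set c" "hd r \<in> set r" "last r \<in> set r"
        using less.prems(1,3) by (auto simp: dicycle_def)
      have "(last c, hd r) \<in> A"
        using adj[of "last c" "hd r"] c no_out less.prems(4) by fastforce
      moreover have "(last r, hd c) \<in> A"
        using adj[of "hd c" "last r"] c no_in less.prems(4) by fastforce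
      ultimately show ?thesis
        using dicycle_append[OF less.prems(1-4)] by (intro exI[of _ "c @ r"]) auto
    qed
  qed
qed

text \<open>The cycle \<open>b\<close> is cut before \<open>y\<close> and behind \<open>y'\<close>.
  The piece from \<open>y\<close> to \<open>y'\<close> has an entry and an exit by assumption. Once
  it is absorbed, the other piece of \<open>b\<close> starts after \<open>y'\<close> and ends before
  \<open>y\<close>, so both its ends are joined to vertices already on the cycle.\<close>

lemma dicycle_absorb_dicycle:
  assumes c: "dicycle A c" and b: "dicycle A b" and disj: "set c \<inter> set b = {}"
    and adj: "\<And>x y. x \<in> set c \<union> set b \<Longrightarrow> y \<in> set b \<Longrightarrow> x \<noteq> y \<Longrightarrow> (x, y) \<in> A \<or> (y, x) \<in> A"
    and inn: "x \<in> set c" "y \<in> set b" "(x, y) \<in> A"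
    and out: "x' \<in> set c" "y' \<in> set b" "(y', x') \<in> A"
  shows "\<exists>c'. dicycle A c' \<and> set c' = set c \<union> set b"
proof -
  obtain ys where ys: "dicycle A (y # ys)" "set (y # ys) = set b"
    using dicycle_rotate_hd[OF b inn(2)] by metis
  obtain us vs where uv: "y # ys = us @ y' # vs"
    using out(2) ys(2) by (metis split_list)
  define r where "r = us @ [y']"
  have r: "y # ys = r @ vs" "r \<noteq> []" "last r = y'"
    using uv by (auto simp: r_def)
  have hd_r: "hd r = y"
    using r(1,2) by (metis hd_append2 list.sel(1))
  have path: "dipath A (r @ vs)" and closed: "2 \<le> length (r @ vs) \<Longrightarrow> (last (r @ vs), hd (r @ vs)) \<in> A"
    using ys(1) r(1) by (auto simp: dicycle_def)
  have sets: "set b = set r \<union> set vs"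
    using ys(2) r(1) by (metis set_append)
  have "\<exists>c1. dicycle A c1 \<and> set c1 = set c \<union> set r"
  proof (rule dicycle_absorb_path[OF c _ r(2)])
    show "dipath A r" "set c \<inter> set r = {}"
      using path disj sets by (auto simp: dipath_append_iff)
    show "(u, v) \<in> A \<or> (v, u) \<in> A" if "u \<in> set c \<union> set r" "v \<in> set r" "u \<noteq> v" for u v
      using adj[of u v] that sets by auto
  qed (use inn out r hd_r in auto)
  then obtain c1 where c1: "dicycle A c1" "set c1 = set c \<union> set r"
    by blast
  show ?thesis
  proof (cases "vs = []")
    case True
    then show ?thesis using c1 sets by auto
  next
    case False
    have "\<exists>c2. dicycle A c2 \<and> set c2 = set c1 \<union> set vs"
    proof (rule dicycle_absorb_path[OF c1(1) _ False])
      show "dipath A vs" "set c1 \<inter> set vs = {}"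
        using path disj sets c1 by (auto simp: dipath_append_iff)
      show "(u, v) \<in> A \<or> (v, u) \<in> A" if "u \<in> set c1 \<union> set vs" "v \<in> set vs" "u \<noteq> v" for u v
        using adj[of u v] that sets c1 by auto
      show "\<exists>x\<in>set c1. (x, hd vs) \<in> A"
        using path False r(2) c1(2) by (intro bexI[of _ "last r"]) (auto simp: dipath_append_iff)
      have "2 \<le> length (r @ vs)"
        using False r(2) by (cases r; cases vs) auto
      then show "\<exists>x\<in>set c1. (last vs, x) \<in> A"
        using closed False r(2) c1(2) by (intro bexI[of _ "hd r"]) auto
    qed
    then show ?thesis using c1(2) sets by auto
  qed
qed

text \<open>Redei's theorem for semicomplete digraphs: a new vertex goes directly behind the last
  vertex of the path that has an arc to it, or to the front if there is none.\<close>

lemma redei_dipath: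
  assumes "finite M" and "\<And>x y. x \<in> M \<Longrightarrow> y \<in> M \<Longrightarrow> x \<noteq> y \<Longrightarrow> (x, y) \<in> A \<or> (y, x) \<in> A"
  shows "\<exists>xs. dipath A xs \<and> set xs = M"
  using assms
proof (induction M rule: finite_induct)
  case empty
  show ?case by (intro exI[of _ "[]"]) simp
next
  case (insert r M)
  then obtain xs where xs: "dipath A xs" "set xs = M"
    by (metis insertCI)
  show ?case
  proof (cases "\<exists>x\<in>set xs. (x, r) \<in> A")
    case True
    then obtain ys x zs where s: "xs = ys @ x # zs" "(x, r) \<in> A" "\<forall>z\<in>set zs. (z, r) \<notin> A"
      by (rule split_list_last_propE) blast
    have "zs \<noteq> [] \<Longrightarrow> (r, hd zs) \<in> A"
      using insert.prems[of r "hd zs"] s xs insert.hyps(2) by (cases zs) auto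
    then have "dipath A (ys @ x # r # zs)"
      using xs s insert.hyps(2) by (auto simp: dipath_append_iff dipath_Cons_iff)
    then show ?thesis using s xs by (intro exI[of _ "ys @ x # r # zs"]) auto
  next
    case False
    have "xs \<noteq> [] \<Longrightarrow> (r, hd xs) \<in> A"
      using insert.prems[of r "hd xs"] False xs insert.hyps(2) by (cases xs) auto
    then have "dipath A (r # xs)"
      using xs insert.hyps(2) by (auto simp: dipath_Cons_iff)
    then show ?thesis using xs by (intro exI[of _ "r # xs"]) auto
  qed
qed

section \<open>Blow-ups of strong semicomplete digraphs\<close>

lemma concat_disjoint:
  assumes "distinct (concat xss)" and "xs \<in> set xss" and "ys \<in> set xss" and "xs \<noteq> ys"
  shows "set xs \<inter> set ys = {}"
  using assms by (auto simp: distinct_concat_iff)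

text \<open>The vertices of the blow-up are the elements of \<open>'c\<close>; \<open>\<pi>\<close> sends each of them to the vertex
  of the underlying digraph that it is a copy of.\<close>

locale semicomplete_blowup =
  fixes E :: "'b rel" and P :: "'b set" and \<pi> :: "'c \<Rightarrow> 'b"
  assumes irrefl: "(u, u) \<notin> E"
    and adjacent: "u \<in> P \<Longrightarrow> v \<in> P \<Longrightarrow> u \<noteq> v \<Longrightarrow> (u, v) \<in> E \<or> (v, u) \<in> E"
    and leaving_arc: "U \<subseteq> P \<Longrightarrow> U \<noteq> {} \<Longrightarrow> U \<noteq> P \<Longrightarrow> \<exists>u\<in>U. \<exists>v\<in>P - U. (u, v) \<in> E"
begin

definition lift_arcs :: "'c rel" where
  "lift_arcs = {(x, y). (\<pi> x, \<pi> y) \<in> E}"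

lemma lift_arcs_iff: "(x, y) \<in> lift_arcs \<longleftrightarrow> (\<pi> x, \<pi> y) \<in> E"
  by (simp add: lift_arcs_def)

text \<open>\<open>x\<close> and \<open>y\<close> have the same in-neighbours, so the predecessor of
  each on its own cycle also has an arc to the other one, and the two closing arcs can be
  exchanged.\<close>

lemma splice_dicycles:
  assumes c: "dicycle lift_arcs c" "2 \<le> length c" and b: "dicycle lift_arcs b" "2 \<le> length b"
    and disj: "set c \<inter> set b = {}" and xy: "x \<in> set c" "y \<in> set b" "\<pi> x = \<pi> y"
  shows "\<exists>c'. dicycle lift_arcs c' \<and> set c' = set c \<union> set b"
proof -
  obtain xs where xs: "dicycle lift_arcs (x # xs)" "set (x # xs) = set c" "length (x # xs) = length c"
    using dicycle_rotate_hd[OF c(1) xy(1)] .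
  obtain ys where ys: "dicycle lift_arcs (y # ys)" "set (y # ys) = set b" "length (y # ys) = length b"
    using dicycle_rotate_hd[OF b(1) xy(2)] .
  have "(last (x # xs), x) \<in> lift_arcs" "(last (y # ys), y) \<in> lift_arcs"
    using xs(1,3) ys(1,3) b(2) c(2) unfolding dicycle_def by (metis list.sel(1))+
  then have "(last (x # xs), y) \<in> lift_arcs" "(last (y # ys), x) \<in> lift_arcs"
    using xy(3) by (simp_all add: lift_arcs_iff)
  then have "dicycle lift_arcs ((x # xs) @ (y # ys))"
    using disj xs(2) ys(2)
    by (intro dicycle_append[OF xs(1) dicycle_imp_dipath[OF ys(1)]]) (simp_all only: list.sel list.distinct not_False_eq_True)
  then show ?thesis
    using xs(2) ys(2) by (metis set_append)
qed

text \<open>The arc from \<open>x\<close> to \<open>y\<close> joins the two blocks to one path that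
  starts in \<open>b1\<close> and ends in \<open>b2\<close>. Since \<open>c\<close> dominates its
  start and is dominated by its end, the path can be appended to \<open>c\<close>, even if
  \<open>c\<close> is a single vertex.\<close>

lemma absorb_dominated_dominating:
  assumes c: "dicycle lift_arcs c"
    and b1: "dicycle lift_arcs b1" "set c \<inter> set b1 = {}" "\<And>x y. x \<in> set c \<Longrightarrow> y \<in> set b1 \<Longrightarrow> (x, y) \<in> lift_arcs"
    and b2: "dicycle lift_arcs b2" "set c \<inter> set b2 = {}" "\<And>x y. x \<in> set b2 \<Longrightarrow> y \<in> set c \<Longrightarrow> (x, y) \<in> lift_arcs"
    and b12: "set b1 \<inter> set b2 = {}" and xy: "x \<in> set b1" "y \<in> set b2" "(x, y) \<in> lift_arcs"
  shows "\<exists>c'. dicycle lift_arcs c' \<and> set c' = set c \<union> (set b1 \<union> set b2) \<and> 2 \<le> length c'"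
proof -
  obtain xs where xs: "dicycle lift_arcs (xs @ [x])" "set (xs @ [x]) = set b1"
    using dicycle_rotate_last[OF b1(1) xy(1)] by metis
  obtain ys where ys: "dicycle lift_arcs (y # ys)" "set (y # ys) = set b2"
    using dicycle_rotate_hd[OF b2(1) xy(2)] by metis
  define r where "r = (xs @ [x]) @ (y # ys)"
  have sets: "set r = set b1 \<union> set b2"
    unfolding r_def using xs(2) ys(2) by (metis set_append)
  have path: "dipath lift_arcs r"
    unfolding r_def using dicycle_imp_dipath[OF xs(1)] dicycle_imp_dipath[OF ys(1)] xs(2) ys(2) b12 xy(3)
    by (subst dipath_append_iff) (metis last_snoc list.sel(1))
  have "hd r \<in> set b1"
    using xs(2) unfolding r_def by (metis hd_append2 hd_in_set snoc_eq_iff_butlast)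
  moreover have "last r \<in> set b2"
    using ys(2) unfolding r_def by (metis last_appendR last_in_set list.distinct(1))
  moreover have "last c \<in> set c" "hd c \<in> set c"
    using c by (auto simp: dicycle_def)
  ultimately have "dicycle lift_arcs (c @ r)"
    using b1(2,3) b2(2,3) sets by (intro dicycle_append[OF c path]) (auto simp: r_def)
  moreover have "2 \<le> length (c @ r)"
    by (simp add: r_def)
  ultimately show ?thesis
    using sets by (metis set_append)
qed

text \<open>Cycles meeting a common part are spliced, and cycles joined to \<open>c\<close> by arcs in both
  directions are absorbed. Otherwise each block completely dominates \<open>c\<close> or is completely dominated
  by it, and strong connectivity provides an arc from a dominated to a dominating block.\<close>

lemma absorb_blocks:
  assumes "finite \<B>" and "dicycle lift_arcs c"
    and "\<And>b. b \<in> \<B> \<Longrightarrow> dicycle lift_arcs b \<and> inj_on \<pi> (set b)"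
    and "\<And>b. b \<in> \<B> \<Longrightarrow> set c \<inter> set b = {}"
    and "\<And>b b'. b \<in> \<B> \<Longrightarrow> b' \<in> \<B> \<Longrightarrow> b \<noteq> b' \<Longrightarrow> set b \<inter> set b' = {}"
    and "\<pi> ` (set c \<union> \<Union> (set ` \<B>)) = P"
    and "2 \<le> length c \<or> (\<forall>b\<in>\<B>. length b < 2)"
  shows "\<exists>c'. dicycle lift_arcs c' \<and> \<pi> ` set c' = P \<and> set c \<subseteq> set c' \<and>
    (\<forall>b\<in>\<B>. 2 \<le> length b \<longrightarrow> set b \<subseteq> set c') \<and> set c' \<subseteq> set c \<union> \<Union> (set ` \<B>)"
  using assms
proof (induction "card \<B>" arbitrary: \<B> c rule: less_induct)
  case less
  note fin = less.prems(1) and c = less.prems(2) and blk = less.prems(3) and cb = less.prems(4)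
    and bb = less.prems(5) and cover = less.prems(6) and len = less.prems(7)
  \<comment> \<open>The merging cases share this step: the blocks outside \<open>\<B>'\<close> have
    been swallowed by \<open>c1\<close>, and the union of all vertices stays the same.\<close>
  have step: ?case
    if "\<B>' \<subset> \<B>" "dicycle lift_arcs c1" "set c1 = set c \<union> \<Union> (set ` (\<B> - \<B>'))" "2 \<le> length c1" for \<B>' c1
  proof -
    have eq: "set c1 \<union> \<Union> (set ` \<B>') = set c \<union> \<Union> (set ` \<B>)"
      using that(1,3) by blast
    have "\<exists>c'. dicycle lift_arcs c' \<and> \<pi> ` set c' = P \<and> set c1 \<subseteq> set c' \<and>
      (\<forall>b\<in>\<B>'. 2 \<le> length b \<longrightarrow> set b \<subseteq> set c') \<and> set c' \<subseteq> set c1 \<union> \<Union> (set ` \<B>')"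
    proof (rule less.hyps)
      show "card \<B>' < card \<B>" "finite \<B>'"
        using that(1) fin by (auto intro: psubset_card_mono finite_subset)
      show "set c1 \<inter> set b = {}" if b: "b \<in> \<B>'" for b
      proof -
        have "b \<in> \<B>" using b \<open>\<B>' \<subset> \<B>\<close> by blast
        then have "set b' \<inter> set b = {}" if "b' \<in> \<B> - \<B>'" for b'
          using bb[of b' b] that b by blast
        then show ?thesis using cb[OF \<open>b \<in> \<B>\<close>] \<open>set c1 = _\<close> by blast
      qed
      show "\<pi> ` (set c1 \<union> \<Union> (set ` \<B>')) = P"
        unfolding eq by (rule cover)
      show "set b \<inter> set b' = {}" if "b \<in> \<B>'" "b' \<in> \<B>'" "b \<noteq> b'" for b b'
        using bb[of b b'] that \<open>\<B>' \<subset> \<B>\<close> by blast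
    qed (use that blk in auto)
    then obtain c' where c': "dicycle lift_arcs c'" "\<pi> ` set c' = P" "set c1 \<subseteq> set c'"
      "\<forall>b\<in>\<B>'. 2 \<le> length b \<longrightarrow> set b \<subseteq> set c'" "set c' \<subseteq> set c \<union> \<Union> (set ` \<B>)"
      unfolding eq by blast
    have "set b \<subseteq> set c'" if "b \<in> \<B>" "2 \<le> length b" for b
      using that c'(3,4) \<open>set c1 = _\<close> by (cases "b \<in> \<B>'") auto
    moreover have "set c \<subseteq> set c'"
      using c'(3) \<open>set c1 = _\<close> by blast
    ultimately show ?thesis
      using c' by blast
  qed
  have inP: "\<pi> x \<in> P" if "x \<in> set c \<or> (\<exists>b\<in>\<B>. x \<in> set b)" for x
    using that cover by blast
  show ?case
  proof (cases "\<exists>b\<in>\<B>. \<exists>x\<in>set c. \<exists>y\<in>set b. \<pi> x = \<pi> y")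
    case True
    then obtain b x y where b: "b \<in> \<B>" and xy: "x \<in> set c" "y \<in> set b" "\<pi> x = \<pi> y"
      by blast
    show ?thesis
    proof (cases "2 \<le> length b")
      case True
      \<comment> \<open>A trivial \<open>c\<close> could not be spliced with \<open>b\<close>, as
        this would take an arc inside a part. The length hypothesis excludes it.\<close>
      then have "2 \<le> length c" using len b by fastforce
      then obtain c1 where c1: "dicycle lift_arcs c1" "set c1 = set c \<union> set b"
        using splice_dicycles[OF c _ _ True cb[OF b] xy] blk[OF b] by blast
      have "card (set c) \<le> card (set c1)"
        using c1(2) by (intro card_mono) auto
      moreover have "card (set c) = length c" "card (set c1) = length c1"
        using c c1(1) by (auto simp: dicycle_def dipath_def distinct_card)
      ultimately have "2 \<le> length c1"
        using \<open>2 \<le> length c\<close> by simp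
      moreover have "\<B> - (\<B> - {b}) = {b}" using b by blast
      ultimately show ?thesis
        using step[of "\<B> - {b}" c1] c1 b by auto
    next
      case False
      then obtain z where "b = [z]"
        using blk[OF b] by (cases b rule: list.exhaust; auto simp: dicycle_def Suc_le_eq)
      with xy have z: "b = [y]" by simp
      have "\<exists>c'. dicycle lift_arcs c' \<and> \<pi> ` set c' = P \<and> set c \<subseteq> set c' \<and>
        (\<forall>b\<in>\<B> - {b}. 2 \<le> length b \<longrightarrow> set b \<subseteq> set c') \<and> set c' \<subseteq> set c \<union> \<Union> (set ` (\<B> - {b}))"
      proof (rule less.hyps)
        show "card (\<B> - {b}) < card \<B>"
          using fin b by (rule card_Diff1_less)
        have "\<pi> y \<in> \<pi> ` set c" using xy by (metis imageI)
        then have "\<pi> y \<in> \<pi> ` (set c \<union> \<Union> (set ` (\<B> - {b})))"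
          by blast
        moreover have "set c \<union> \<Union> (set ` \<B>) = set b \<union> (set c \<union> \<Union> (set ` (\<B> - {b})))"
          using b by blast
        ultimately show "\<pi> ` (set c \<union> \<Union> (set ` (\<B> - {b}))) = P"
          unfolding cover[symmetric] z by (simp add: insert_absorb)
      qed (use fin c blk cb bb len in auto)
      then show ?thesis
        by (elim ex_forward) (use z in auto)
    qed
  next
    case disjoint_parts: False
    have adj: "(x, y) \<in> lift_arcs \<or> (y, x) \<in> lift_arcs" if "x \<in> set c" "b \<in> \<B>" "y \<in> set b" for x y b
      using adjacent[of "\<pi> x" "\<pi> y"] that inP disjoint_parts unfolding lift_arcs_iff by blast
    show ?thesis
    proof (cases "\<exists>b\<in>\<B>. \<exists>x\<in>set c. \<exists>y\<in>set b. \<exists>x'\<in>set c. \<exists>y'\<in>set b. (x, y) \<in> lift_arcs \<and> (y', x') \<in> lift_arcs")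
      case True
      then obtain b x y x' y' where b: "b \<in> \<B>" and xy: "x \<in> set c" "y \<in> set b" "(x, y) \<in> lift_arcs"
        and xy': "x' \<in> set c" "y' \<in> set b" "(y', x') \<in> lift_arcs"
        by blast
      have "\<exists>c1. dicycle lift_arcs c1 \<and> set c1 = set c \<union> set b"
      proof (rule dicycle_absorb_dicycle[OF c _ cb[OF b] _ xy xy'])
        fix u v assume uv: "u \<in> set c \<union> set b" "v \<in> set b" "u \<noteq> v"
        show "(u, v) \<in> lift_arcs \<or> (v, u) \<in> lift_arcs"
        proof (cases "u \<in> set c")
          case True
          then show ?thesis using adj b uv by blast
        next
          case False
          then have "\<pi> u \<noteq> \<pi> v"
            using uv blk[OF b] by (auto dest: inj_onD)
          then show ?thesis
            using adjacent[of "\<pi> u" "\<pi> v"] uv b inP False unfolding lift_arcs_iff by blast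
        qed
      qed (use blk b in blast)
      then obtain c1 where c1: "dicycle lift_arcs c1" "set c1 = set c \<union> set b"
        by blast
      \<comment> \<open>This also serves a trivial \<open>c\<close>: the merged cycle contains
        \<open>x\<close> and \<open>y\<close>, so the length hypothesis holds for the recursive
        call.\<close>
      have "x \<noteq> y" using xy cb[OF b] by blast
      then have "card {x, y} = 2" by simp
      moreover have "card {x, y} \<le> card (set c1)"
        using c1(2) xy by (intro card_mono) auto
      ultimately have "2 \<le> length c1"
        using card_length[of c1] by linarith
      moreover have "\<B> - (\<B> - {b}) = {b}" using b by blast
      ultimately show ?thesis
        using step[of "\<B> - {b}" c1] c1 b by auto
    next
      case one_way: False
      show ?thesis
      proof (cases "\<B> = {}")
        case True
        then show ?thesis using c cover by auto
      next
        case False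
        define Out where "Out = {b \<in> \<B>. \<forall>x\<in>set c. \<forall>y\<in>set b. (x, y) \<in> lift_arcs \<and> (y, x) \<notin> lift_arcs}"
        define In where "In = {b \<in> \<B>. \<forall>x\<in>set c. \<forall>y\<in>set b. (y, x) \<in> lift_arcs \<and> (x, y) \<notin> lift_arcs}"
        have hc: "hd c \<in> set c" using c by (simp add: dicycle_def)
        have hb: "hd b \<in> set b" if "b \<in> \<B>" for b
          using blk[OF that] by (simp add: dicycle_def)
        have OI: "\<B> = Out \<union> In"
        proof -
          have "b \<in> Out \<union> In" if b: "b \<in> \<B>" for b
          proof (cases "(hd c, hd b) \<in> lift_arcs")
            case True
            then have "\<forall>x\<in>set c. \<forall>y\<in>set b. (y, x) \<notin> lift_arcs"
              using one_way hc hb[OF b] b by blast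
            then show ?thesis using adj b unfolding Out_def by blast
          next
            case False
            then have "(hd b, hd c) \<in> lift_arcs" using adj[OF hc b hb[OF b]] by blast
            then have "\<forall>x\<in>set c. \<forall>y\<in>set b. (x, y) \<notin> lift_arcs"
              using one_way hc hb[OF b] b by blast
            then show ?thesis using adj b unfolding In_def by blast
          qed
          then show ?thesis unfolding Out_def In_def by blast
        qed
        have "\<exists>b1\<in>Out. \<exists>b2\<in>In. \<exists>x\<in>set b1. \<exists>y\<in>set b2. (x, y) \<in> lift_arcs"
        proof (rule ccontr)
          assume no_arc: "\<not> ?thesis"
          show False
          proof (cases "In = {}")
            case True
            \<comment> \<open>Without blocks that dominate \<open>c\<close>, an arc leaving the
              parts of the blocks would run from an \<open>Out\<close> block to
              \<open>c\<close>.\<close>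
            define U where "U = \<pi> ` (\<Union> (set ` \<B>))"
            have "U \<noteq> {}" using False hb unfolding U_def by blast
            moreover have "\<pi> (hd c) \<notin> U"
              using disjoint_parts hc unfolding U_def by auto
            ultimately obtain u v where "u \<in> U" "v \<in> P - U" "(u, v) \<in> E"
              using leaving_arc[of U] inP[of "hd c"] hc cover unfolding U_def by blast
            moreover then obtain z where "z \<in> set c" "v = \<pi> z"
              using cover unfolding U_def by blast
            moreover obtain b y where "b \<in> \<B>" "y \<in> set b" "u = \<pi> y"
              using \<open>u \<in> U\<close> unfolding U_def by blast
            ultimately have "(y, z) \<in> lift_arcs" "b \<in> Out" using OI True by (auto simp: lift_arcs_iff)
            then show False using \<open>z \<in> set c\<close> \<open>y \<in> set b\<close> unfolding Out_def by blast
          next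
            case nonempty: False
            \<comment> \<open>The parts of \<open>c\<close> and \<open>Out\<close> are left by an
              arc into a part of some \<open>In\<close> block. It cannot start in \<open>c\<close>,
              by definition of \<open>In\<close>, nor in an \<open>Out\<close> block, by
              assumption.\<close>
            define U where "U = \<pi> ` (set c \<union> \<Union> (set ` Out))"
            have U: "U \<noteq> {}" "U \<subseteq> P" using hc cover OI unfolding U_def by auto
            obtain b where b: "b \<in> In" using nonempty by blast
            have "\<pi> (hd b) \<notin> U"
            proof
              assume "\<pi> (hd b) \<in> U"
              then consider x where "x \<in> set c" "\<pi> (hd b) = \<pi> x"
                | b' y where "b' \<in> Out" "y \<in> set b'" "\<pi> (hd b) = \<pi> y"
                unfolding U_def by blast
              then show False
              proof cases
                case 1
                then show ?thesis using disjoint_parts b hb OI by (metis UnCI)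
              next
                case 2
                \<comment> \<open>\<open>y\<close> and \<open>hd b\<close> lie in the same part, so
                  an arc to one is an arc to the other. Hence no part is shared by an
                  \<open>Out\<close> and an \<open>In\<close> block.\<close>
                then have "(hd c, y) \<in> lift_arcs" using hc unfolding Out_def by blast
                then have "(hd c, hd b) \<in> lift_arcs" using 2 by (simp add: lift_arcs_iff)
                then show ?thesis using b hb hc unfolding In_def by blast
              qed
            qed
            moreover have "\<pi> (hd b) \<in> P" using b hb inP OI by blast
            ultimately have "U \<noteq> P" by blast
            then obtain u v where uv: "u \<in> U" "v \<in> P - U" "(u, v) \<in> E"
              using leaving_arc[OF U(2,1)] by blast
            then obtain z where "z \<in> set c \<union> \<Union> (set ` \<B>)" "v = \<pi> z"
              using cover by (metis DiffD1 imageE)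
            then obtain b2 where b2: "b2 \<in> In" "z \<in> set b2" "v = \<pi> z"
              using uv(2) OI unfolding U_def by blast
            obtain w where w: "w \<in> set c \<union> \<Union> (set ` Out)" "u = \<pi> w"
              using uv(1) unfolding U_def by blast
            have "(w, z) \<in> lift_arcs" using w b2 uv(3) by (simp add: lift_arcs_iff)
            then show False using w(1) b2 no_arc unfolding In_def by blast
          qed
        qed
        then obtain b1 b2 x y where b: "b1 \<in> Out" "b2 \<in> In" and xy: "x \<in> set b1" "y \<in> set b2" "(x, y) \<in> lift_arcs"
          by blast
        have bs: "b1 \<in> \<B>" "b2 \<in> \<B>" using b OI by auto
        have "b1 \<noteq> b2"
          using b hc hb[OF bs(1)] unfolding Out_def In_def by blast
        then have "\<exists>c1. dicycle lift_arcs c1 \<and> set c1 = set c \<union> (set b1 \<union> set b2) \<and> 2 \<le> length c1"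
          using blk bs cb bb b xy c unfolding Out_def In_def
          by (intro absorb_dominated_dominating[where x = x and y = y]) auto
        moreover have "\<B> - (\<B> - {b1, b2}) = {b1, b2}" using bs by blast
        ultimately show ?thesis
          using step[of "\<B> - {b1, b2}"] bs by fastforce
      qed
    qed
  qed
qed

text \<open>When the next vertex \<open>x\<close> falls into the part of an earlier
  \<open>y\<close>, the end of \<open>t\<close> has an arc to \<open>x\<close> and therefore also to
  \<open>y\<close>; this closes the section from \<open>y\<close> on to a cycle, while
  \<open>x\<close> takes the place of \<open>y\<close> in \<open>t\<close>. As no arc runs inside a
  part, \<open>y\<close> is not the end of \<open>t\<close>, so the cycle is proper. Keeping
  \<open>last t = last l\<close> is what allows the next vertex to be appended.\<close>

lemma split_off_dicycles:
  assumes "dipath lift_arcs l" and "l \<noteq> []"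
  shows "\<exists>t cs. dipath lift_arcs t \<and> inj_on \<pi> (set t) \<and> t \<noteq> [] \<and> last t = last l \<and>
    (\<forall>c\<in>set cs. dicycle lift_arcs c \<and> inj_on \<pi> (set c) \<and> 2 \<le> length c) \<and>
    distinct (t @ concat cs) \<and> set (t @ concat cs) = set l"
  using assms
proof (induction l rule: rev_induct)
  case (snoc x l)
  show ?case
  proof (cases "l = []")
    case True
    then show ?thesis by (intro exI[of _ "[x]"] exI[of _ "[]"]) auto
  next
    case False
    obtain t cs where t: "dipath lift_arcs t" "inj_on \<pi> (set t)" "t \<noteq> []" "last t = last l"
      and cs: "\<forall>c\<in>set cs. dicycle lift_arcs c \<and> inj_on \<pi> (set c) \<and> 2 \<le> length c"
      and dist: "distinct (t @ concat cs)" and set_l: "set (t @ concat cs) = set l"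
      using snoc.IH snoc.prems False unfolding dipath_append_iff by blast
    have x: "x \<notin> set (t @ concat cs)" and arc: "(last t, x) \<in> lift_arcs"
      using snoc.prems False t(4) set_l by (auto simp: dipath_append_iff)
    show ?thesis
    proof (cases "\<pi> x \<in> \<pi> ` set t")
      case False
      have "dipath lift_arcs (t @ [x])"
        using t arc x by (simp add: dipath_append_iff)
      then show ?thesis
        using False t cs dist set_l x
        by (intro exI[of _ "t @ [x]"] exI[of _ cs]) auto
    next
      case True
      then obtain y where y: "y \<in> set t" "\<pi> y = \<pi> x" by force
      obtain us vs where uv: "t = us @ y # vs" using y(1) by (meson split_list)
      have "vs \<noteq> []"
        using arc uv y(2) irrefl by (auto simp: lift_arcs_iff)
      then have last: "last t = last vs" using uv by simp
      have "(last vs, y) \<in> lift_arcs" using arc last y(2) by (simp add: lift_arcs_iff)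
      then have cyc: "dicycle lift_arcs (y # vs)" "2 \<le> length (y # vs)"
        using t(1) uv \<open>vs \<noteq> []\<close> by (auto simp: dicycle_def dipath_append_iff Suc_le_eq)
      have "us \<noteq> [] \<Longrightarrow> (last us, x) \<in> lift_arcs"
        using t(1) uv y(2) by (auto simp: dipath_append_iff lift_arcs_iff)
      then have path: "dipath lift_arcs (us @ [x])"
        using t(1) uv x by (auto simp: dipath_append_iff)
      have "\<pi> x \<notin> \<pi> ` set us" "inj_on \<pi> (set us)" "inj_on \<pi> (set (y # vs))"
        using t(1,2) y(2) unfolding uv by (auto simp: dipath_def inj_on_Un)
      then have inj: "inj_on \<pi> (set (us @ [x]))" "inj_on \<pi> (set (y # vs))"
        by auto
      show ?thesis
      proof (intro exI[of _ "us @ [x]"] exI[of _ "(y # vs) # cs"] conjI)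
        show "distinct ((us @ [x]) @ concat ((y # vs) # cs))"
          using dist x uv by auto
        show "set ((us @ [x]) @ concat ((y # vs) # cs)) = set (l @ [x])"
          using set_l uv by auto
      qed (use path inj cyc cs in auto)
    qed
  qed
qed simp

lemma split_off_dicycles_list:
  assumes "\<And>l. l \<in> set ls \<Longrightarrow> dipath lift_arcs l \<and> l \<noteq> []" and "distinct (concat ls)"
  shows "\<exists>ts cs. length ts = length ls \<and> (\<forall>t\<in>set ts. inj_on \<pi> (set t)) \<and>
    (\<forall>c\<in>set cs. dicycle lift_arcs c \<and> inj_on \<pi> (set c) \<and> 2 \<le> length c) \<and>
    distinct (concat ts @ concat cs) \<and> set (concat ts @ concat cs) = set (concat ls)"
  using assms
proof (induction ls)
  case Nil
  show ?case by (intro exI[of _ "[]"]) auto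
next
  case (Cons l ls)
  obtain ts cs where *: "length ts = length ls" "\<forall>t\<in>set ts. inj_on \<pi> (set t)"
    "\<forall>c\<in>set cs. dicycle lift_arcs c \<and> inj_on \<pi> (set c) \<and> 2 \<le> length c"
    "distinct (concat ts @ concat cs)" "set (concat ts @ concat cs) = set (concat ls)"
    using Cons.IH Cons.prems by auto
  obtain t cs' where **: "inj_on \<pi> (set t)"
    "\<forall>c\<in>set cs'. dicycle lift_arcs c \<and> inj_on \<pi> (set c) \<and> 2 \<le> length c"
    "distinct (t @ concat cs')" "set (t @ concat cs') = set l"
    using split_off_dicycles[of l] Cons.prems(1)[of l] by auto
  have "set l \<inter> set (concat ls) = {}" using Cons.prems(2) by auto
  then have disj: "set (t @ concat cs') \<inter> set (concat ts @ concat cs) = {}"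
    using *(5) **(4) by simp
  show ?case
  proof (rule exI[of _ "t # ts"], rule exI[of _ "cs' @ cs"], intro conjI)
    show "distinct (concat (t # ts) @ concat (cs' @ cs))"
      using *(4) **(3) disj by auto
    show "set (concat (t # ts) @ concat (cs' @ cs)) = set (concat (l # ls))"
      using *(5) **(4) by auto
  qed (use * ** in auto)
qed

theorem spanning_cycle_and_paths:
  assumes ls: "\<And>l. l \<in> set ls \<Longrightarrow> dipath lift_arcs l \<and> l \<noteq> []" and dist: "distinct (concat ls)"
    and cover: "\<pi> ` set (concat ls) = P" and card: "2 \<le> card P"
  shows "\<exists>c rs. dicycle lift_arcs c \<and> 2 \<le> length c \<and> \<pi> ` set c = P \<and> length rs \<le> length ls \<and>
    (\<forall>r\<in>set rs. dipath lift_arcs r \<and> r \<noteq> []) \<and>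
    distinct (c @ concat rs) \<and> set (c @ concat rs) = set (concat ls)"
proof -
  obtain ts cs where ts: "length ts = length ls" "\<forall>t\<in>set ts. inj_on \<pi> (set t)"
    and cs: "\<forall>c\<in>set cs. dicycle lift_arcs c \<and> inj_on \<pi> (set c) \<and> 2 \<le> length c"
    and dist': "distinct (concat ts @ concat cs)"
    and sets: "set (concat ts @ concat cs) = set (concat ls)"
    using split_off_dicycles_list[OF ls dist] by blast
  \<comment> \<open>The vertices of the remnants enter as trivial cycles, so that absorption can
    pick some of them up to reach parts that the split-off cycles miss.\<close>
  define \<B> where "\<B> = set cs \<union> (\<lambda>x. [x]) ` set (concat ts)"
  have U\<B>: "\<Union> (set ` \<B>) = set (concat ls)"
    unfolding \<B>_def sets[symmetric] by auto
  have disj: "set b \<inter> set b' = {}" if "b \<in> \<B>" "b' \<in> \<B>" "b \<noteq> b'" for b b'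
  proof -
    have 1: "distinct (concat cs)" "set (concat ts) \<inter> set (concat cs) = {}"
      using dist' by auto
    show ?thesis
      using that concat_disjoint[OF 1(1), of b b'] 1(2) unfolding \<B>_def by fastforce
  qed
  have blk: "dicycle lift_arcs b \<and> inj_on \<pi> (set b)" if "b \<in> \<B>" for b
    using that cs unfolding \<B>_def by auto
  have "\<B> \<noteq> {}"
  proof
    assume "\<B> = {}"
    then have "P = {}" using U\<B> cover by auto
    then show False using card by simp
  qed
  \<comment> \<open>The starting block is proper whenever a proper block exists, as the length
    hypothesis of \<open>absorb_blocks\<close> demands.\<close>
  then have "\<exists>c0\<in>\<B>. 2 \<le> length c0 \<or> (\<forall>b\<in>\<B>. length b < 2)"
    by (meson not_le ex_in_conv)
  then obtain c0 where c0: "c0 \<in> \<B>" "2 \<le> length c0 \<or> (\<forall>b\<in>\<B>. length b < 2)"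
    by blast
  have U0: "set c0 \<union> \<Union> (set ` (\<B> - {c0})) = set (concat ls)"
    using c0(1) U\<B> by blast
  have "\<exists>c. dicycle lift_arcs c \<and> \<pi> ` set c = P \<and> set c0 \<subseteq> set c \<and>
    (\<forall>b\<in>\<B> - {c0}. 2 \<le> length b \<longrightarrow> set b \<subseteq> set c) \<and> set c \<subseteq> set c0 \<union> \<Union> (set ` (\<B> - {c0}))"
  proof (rule absorb_blocks)
    show "finite (\<B> - {c0})" unfolding \<B>_def by simp
    show "\<pi> ` (set c0 \<union> \<Union> (set ` (\<B> - {c0}))) = P" using U0 cover by simp
  qed (use c0 blk disj in auto)
  then obtain c where c: "dicycle lift_arcs c" "\<pi> ` set c = P" "set c0 \<subseteq> set c"
    "\<forall>b\<in>\<B> - {c0}. 2 \<le> length b \<longrightarrow> set b \<subseteq> set c" "set c \<subseteq> set (concat ls)"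
    unfolding U0 by blast
  \<comment> \<open>Even if all blocks are trivial, the result is a proper cycle because it meets at
    least two parts.\<close>
  have "card P \<le> length c"
    using c(2) by (metis card_image_le card_length finite_set le_trans)
  then have len: "2 \<le> length c" using card by simp
  have cs_in: "set (concat cs) \<subseteq> set c"
  proof -
    have "set b \<subseteq> set c" if "b \<in> set cs" for b
      using that c(3,4) cs unfolding \<B>_def by (cases "b = c0") auto
    then show ?thesis by auto
  qed
  \<comment> \<open>The vertices of \<open>t\<close> that the cycle did not take still lie in
    different parts and are pairwise adjacent. Their order on the original path may be lost, so a
    new path is chosen.\<close>
  have "\<exists>r. dipath lift_arcs r \<and> set r = set t - set c" if t: "t \<in> set ts" for t
  proof (rule redei_dipath)
    fix x y assume xy: "x \<in> set t - set c" "y \<in> set t - set c" "x \<noteq> y"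
    then have "\<pi> x \<noteq> \<pi> y" using ts(2) t by (auto dest: inj_onD)
    moreover have "x \<in> set (concat ls)" "y \<in> set (concat ls)"
      using xy t unfolding sets[symmetric] by auto
    then have "\<pi> x \<in> P" "\<pi> y \<in> P"
      using cover by blast+
    ultimately show "(x, y) \<in> lift_arcs \<or> (y, x) \<in> lift_arcs"
      using adjacent unfolding lift_arcs_iff by blast
  qed simp
  then obtain f where f: "\<And>t. t \<in> set ts \<Longrightarrow> dipath lift_arcs (f t) \<and> set (f t) = set t - set c"
    by metis
  \<comment> \<open>Remnants swallowed completely are discarded, since an ear needs a new vertex;
    this is why the number of paths is only bounded above.\<close>
  define rs where "rs = filter (\<lambda>r. r \<noteq> []) (map f ts)"
  have concat_rs: "concat rs = concat (map f ts)"
    unfolding rs_def by (induction ts) auto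
  have set_rs: "set (concat rs) = set (concat ts) - set c"
    unfolding concat_rs using f by auto
  have "distinct (concat (map f us))" if "distinct (concat us)" "set us \<subseteq> set ts" for us
    using that
  proof (induction us)
    case (Cons u us)
    have sub: "set (f v) \<subseteq> set v" if "v \<in> set (u # us)" for v
      using that f Cons.prems(2) by blast
    then have "set (concat (map f us)) \<subseteq> set (concat us)"
      by auto
    moreover have "set u \<inter> set (concat us) = {}"
      using Cons.prems(1) by auto
    ultimately have "set (f u) \<inter> set (concat (map f us)) = {}"
      using sub[of u] by (meson disjoint_iff list.set_intros(1) subsetD)
    moreover have "distinct (f u)" using f[of u] Cons.prems(2) by (simp add: dipath_def)
    moreover have "distinct (concat (map f us))" using Cons.IH Cons.prems by auto
    ultimately show ?case by simp
  qed simp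
  then have "distinct (concat rs)" unfolding concat_rs using dist' by simp
  moreover have "distinct c" using c(1) by (simp add: dicycle_def dipath_def)
  ultimately have "distinct (c @ concat rs)" unfolding distinct_append set_rs by blast
  moreover have "set (c @ concat rs) = set (concat ls)"
    using c(5) cs_in unfolding set_append set_rs sets[symmetric] by blast
  moreover have "length rs \<le> length ls"
    unfolding rs_def using ts(1) by (metis length_filter_le length_map)
  moreover have "\<forall>r\<in>set rs. dipath lift_arcs r \<and> r \<noteq> []"
    unfolding rs_def using f by auto
  ultimately show ?thesis using c(1,2) len by blast
qed

end

section \<open>Strong subdigraphs from a cycle and ears\<close>

text \<open>The consecutive pairs of the walk from \<open>a\<close> through \<open>r\<close> to
  \<open>b\<close>. With \<open>a = b\<close> these are the arcs of a cycle, so cycles and ears are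
  counted alike; the same zip serves as the arc list of a Hamiltonian cycle.\<close>

definition ear_arcs :: "'a \<Rightarrow> 'a list \<Rightarrow> 'a \<Rightarrow> 'a rel" where
  "ear_arcs a r b = set (zip (a # r) (r @ [b]))"

lemma ear_arcs_Nil [simp]: "ear_arcs a [] b = {(a, b)}"
  by (simp add: ear_arcs_def)

lemma ear_arcs_Cons [simp]: "ear_arcs a (x # r) b = insert (a, x) (ear_arcs x r b)"
  by (simp add: ear_arcs_def)

lemma finite_ear_arcs [simp]: "finite (ear_arcs a r b)"
  by (simp add: ear_arcs_def)

lemma card_ear_arcs_le: "card (ear_arcs a r b) \<le> length r + 1"
  unfolding ear_arcs_def by (rule order.trans[OF card_length]) simp

lemma card_ear_arcs: "distinct (a # r) \<Longrightarrow> card (ear_arcs a r b) = length r + 1"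
  unfolding ear_arcs_def by (subst distinct_card) (auto simp: distinct_zipI1)

lemma ear_arcs_subset:
  "dipath A r \<Longrightarrow> r \<noteq> [] \<Longrightarrow> (a, hd r) \<in> A \<Longrightarrow> (last r, b) \<in> A \<Longrightarrow> ear_arcs a r b \<subseteq> A"
proof (induction r arbitrary: a)
  case (Cons x r)
  then show ?case by (cases "r = []") (auto simp: dipath_Cons_iff)
qed simp

lemma ear_arcs_verts: "ear_arcs a r b \<subseteq> insert a (set r) \<times> insert b (set r)"
  by (induction r arbitrary: a) auto

text \<open>Needed for exact counting: the arcs of an ear with interior vertices are disjoint from
  all arcs inside the part built so far.\<close>

lemma ear_arcs_outside:
  "r \<noteq> [] \<Longrightarrow> set r \<inter> W = {} \<Longrightarrow> ear_arcs a r b \<inter> W \<times> W = {}"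
proof (induction r arbitrary: a)
  case (Cons x r)
  then show ?case by (cases "r = []") auto
qed simp

lemma ear_arcs_reach_from: "x \<in> set r \<union> {b} \<Longrightarrow> (a, x) \<in> (ear_arcs a r b)\<^sup>*"
proof (induction r arbitrary: a)
  case (Cons y r)
  have "(ear_arcs y r b)\<^sup>* \<subseteq> (ear_arcs a (y # r) b)\<^sup>*"
    by (rule rtrancl_mono) auto
  then have "(y, x) \<in> (ear_arcs a (y # r) b)\<^sup>*"
    using Cons.IH[of y] Cons.prems by (cases "x = y") auto
  then show ?case by (rule converse_rtrancl_into_rtrancl[rotated]) simp
qed auto

lemma ear_arcs_reach_to: "x \<in> set r \<union> {a} \<Longrightarrow> (x, b) \<in> (ear_arcs a r b)\<^sup>*"
proof (induction r arbitrary: a)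
  case (Cons y r)
  have "(ear_arcs y r b)\<^sup>* \<subseteq> (ear_arcs a (y # r) b)\<^sup>*"
    by (rule rtrancl_mono) auto
  then show ?case
    using Cons.IH[of y] Cons.prems ear_arcs_reach_from[of b "y # r" b a] by (cases "x = a") auto
qed auto

definition strong_on :: "'a set \<Rightarrow> 'a rel \<Rightarrow> bool" where
  "strong_on V B \<longleftrightarrow> (\<forall>u\<in>V. \<forall>v\<in>V. (u, v) \<in> B\<^sup>*)"

lemma strong_on_add_ear:
  assumes "strong_on W B" and ab: "a \<in> W" "b \<in> W"
  shows "strong_on (W \<union> set r) (B \<union> ear_arcs a r b)"
proof -
  let ?B = "B \<union> ear_arcs a r b"
  have W: "(u, v) \<in> ?B\<^sup>*" if "u \<in> W" "v \<in> W" for u v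
    using assms(1) that rtrancl_mono[of B ?B] unfolding strong_on_def by blast
  have E: "(ear_arcs a r b)\<^sup>* \<subseteq> ?B\<^sup>*"
    by (rule rtrancl_mono) auto
  have from_a: "(a, v) \<in> ?B\<^sup>*" if "v \<in> W \<union> set r" for v
    using that W[OF ab(1)] ear_arcs_reach_from[of v r b a] E by auto
  have to_b: "(u, b) \<in> ?B\<^sup>*" if "u \<in> W \<union> set r" for u
    using that W[OF _ ab(2)] ear_arcs_reach_to[of u r a b] E by auto
  show ?thesis
    unfolding strong_on_def using from_a to_b W[OF ab(2,1)] by (meson rtrancl_trans)
qed

text \<open>All ears have both ends in the base set \<open>W\<close>, not in earlier ears, so they
  can be attached in any order; each costs one arc more than it has vertices.\<close>

lemma strong_on_add_ears:
  assumes "strong_on W B" and "finite B"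
    and "\<And>r. r \<in> set rs \<Longrightarrow> dipath A r \<and> r \<noteq> [] \<and> (\<exists>a\<in>W. (a, hd r) \<in> A) \<and> (\<exists>b\<in>W. (last r, b) \<in> A)"
  shows "\<exists>B'. finite B' \<and> B' \<subseteq> B \<union> A \<and> strong_on (W \<union> set (concat rs)) B' \<and>
    card B' \<le> card B + length (concat rs) + length rs"
  using assms(3)
proof (induction rs)
  case Nil
  then show ?case using assms(1,2) by (intro exI[of _ B]) auto
next
  case (Cons r rs)
  obtain B' where B': "finite B'" "B' \<subseteq> B \<union> A" "strong_on (W \<union> set (concat rs)) B'"
    "card B' \<le> card B + length (concat rs) + length rs"
    using Cons by auto
  obtain a b where ab: "a \<in> W" "(a, hd r) \<in> A" "b \<in> W" "(last r, b) \<in> A" and r: "dipath A r" "r \<noteq> []"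
    using Cons.prems[of r] by auto
  have "strong_on ((W \<union> set (concat rs)) \<union> set r) (B' \<union> ear_arcs a r b)"
    using B'(3) ab by (intro strong_on_add_ear) auto
  moreover have "ear_arcs a r b \<subseteq> A"
    using ear_arcs_subset[OF r ab(2,4)] .
  moreover have "card (B' \<union> ear_arcs a r b) \<le> card B' + (length r + 1)"
    using card_Un_le[of B' "ear_arcs a r b"] card_ear_arcs_le[of a r b] by linarith
  moreover have "(W \<union> set (concat rs)) \<union> set r = W \<union> set (concat (r # rs))" by auto
  ultimately show ?case
    using B' by (intro exI[of _ "B' \<union> ear_arcs a r b"]) auto
qed

lemma strong_subdigraph_of_cycle_and_ears:
  assumes c: "dicycle A c" "2 \<le> length c" and dist: "distinct (c @ concat rs)"
    and rs: "\<And>r. r \<in> set rs \<Longrightarrow>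
      dipath A r \<and> r \<noteq> [] \<and> (\<exists>a\<in>set c. (a, hd r) \<in> A) \<and> (\<exists>b\<in>set c. (last r, b) \<in> A)"
  shows "\<exists>B. finite B \<and> B \<subseteq> A \<and> strong_on (set (c @ concat rs)) B \<and>
    card B \<le> card (set (c @ concat rs)) + length rs"
proof -
  obtain x xs where xs: "c = x # xs" using c(2) by (cases c) auto
  then have ne: "xs \<noteq> []" using c(2) by auto
  let ?B = "ear_arcs x xs x"
  have sub: "?B \<subseteq> A"
    using c xs ne by (intro ear_arcs_subset) (auto simp: dicycle_def dipath_Cons_iff Suc_le_eq)
  \<comment> \<open>The cycle is itself an ear, attached at both ends to the single vertex
    \<open>x\<close>, which is strong without any arc.\<close>
  have "strong_on ({x} \<union> set xs) ({} \<union> ?B)"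
    by (rule strong_on_add_ear) (auto simp: strong_on_def)
  then have "strong_on (set c) ?B" using xs by simp
  then obtain B' where "finite B'" "B' \<subseteq> ?B \<union> A" "strong_on (set c \<union> set (concat rs)) B'"
    "card B' \<le> card ?B + length (concat rs) + length rs"
    using strong_on_add_ears[of "set c" ?B rs A] rs by auto
  moreover have "card ?B \<le> length c"
    using card_ear_arcs_le[of x xs x] xs by simp
  moreover have "card (set (c @ concat rs)) = length c + length (concat rs)"
    using distinct_card[OF dist] by simp
  ultimately show ?thesis
    using sub by (intro exI[of _ B']) auto
qed

section \<open>From a path cover to a strong subdigraph\<close>

text \<open>A vertex joins the first run if it lies in the same part and otherwise opens a run of
  its own. In the latter case the arc behind it joins different parts and therefore comes from
  \<open>E\<close>.\<close>

lemma split_into_runs: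
  assumes "dipath A l" and "l \<noteq> []"
    and "\<And>x y. (x, y) \<in> A \<Longrightarrow> \<rho> x \<noteq> \<rho> y \<Longrightarrow> (\<rho> x, \<rho> y) \<in> E"
  shows "\<exists>ss. ss \<noteq> [] \<and> concat ss = l \<and>
    (\<forall>s\<in>set ss. s \<noteq> [] \<and> dipath A s \<and> (\<forall>x\<in>set s. \<rho> x = \<rho> (hd s))) \<and>
    successively (\<lambda>s t. (\<rho> (hd s), \<rho> (hd t)) \<in> E) ss"
  using assms(1,2)
proof (induction l)
  case (Cons x l)
  show ?case
  proof (cases "l = []")
    case True
    then show ?thesis by (intro exI[of _ "[[x]]"]) auto
  next
    case False
    have "dipath A l" using Cons.prems(1) by (simp add: dipath_Cons_iff)
    then obtain ss where ss: "ss \<noteq> []" "concat ss = l"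
      "\<forall>s\<in>set ss. s \<noteq> [] \<and> dipath A s \<and> (\<forall>x\<in>set s. \<rho> x = \<rho> (hd s))"
      "successively (\<lambda>s t. (\<rho> (hd s), \<rho> (hd t)) \<in> E) ss"
      using Cons.IH False by blast
    obtain s ss' where s: "ss = s # ss'" using ss(1) by (cases ss) auto
    have hd: "hd l = hd s" "s \<noteq> []" using ss s by auto
    have arc: "(x, hd s) \<in> A" and x: "x \<notin> set l" using Cons.prems False hd by (auto simp: dipath_Cons_iff)
    show ?thesis
    proof (cases "\<rho> x = \<rho> (hd s)")
      case True
      have "dipath A (x # s)" using ss s x arc by (auto simp: dipath_Cons_iff)
      moreover have "\<forall>y\<in>set (x # s). \<rho> y = \<rho> (hd (x # s))"
        using ss(3) s True by (metis list.sel(1) list.set_intros(1) set_ConsD)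
      ultimately have "\<forall>t\<in>set ((x # s) # ss'). t \<noteq> [] \<and> dipath A t \<and> (\<forall>x\<in>set t. \<rho> x = \<rho> (hd t))"
        using ss(3) s by (metis list.distinct(1) list.set_intros(2) set_ConsD)
      moreover have "successively (\<lambda>s t. (\<rho> (hd s), \<rho> (hd t)) \<in> E) ((x # s) # ss')"
        using ss(4) True unfolding s successively_Cons by simp
      moreover have "concat ((x # s) # ss') = x # l"
        using ss(2) s by simp
      ultimately show ?thesis by blast
    next
      case False
      then have "(\<rho> x, \<rho> (hd s)) \<in> E" using assms(3) arc by blast
      then have "successively (\<lambda>s t. (\<rho> (hd s), \<rho> (hd t)) \<in> E) ([x] # ss)"
        using ss(4) unfolding s successively_Cons by simp
      moreover have "\<forall>t\<in>set ([x] # ss). t \<noteq> [] \<and> dipath A t \<and> (\<forall>x\<in>set t. \<rho> x = \<rho> (hd t))"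
      proof
        fix t assume "t \<in> set ([x] # ss)"
        then consider "t = [x]" | "t \<in> set ss" by auto
        then show "t \<noteq> [] \<and> dipath A t \<and> (\<forall>x\<in>set t. \<rho> x = \<rho> (hd t))"
          by cases (simp, use ss(3) in blast)
      qed
      moreover have "concat ([x] # ss) = x # l"
        using ss(2) by simp
      ultimately show ?thesis by blast
    qed
  qed
qed simp

section \<open>Concatenation of runs\<close>

lemma hd_concat_ne: "xs \<noteq> [] \<Longrightarrow> hd xs \<noteq> [] \<Longrightarrow> hd (concat xs) = hd (hd xs)"
  by (cases xs) auto

lemma last_concat_ne: "xs \<noteq> [] \<Longrightarrow> last xs \<noteq> [] \<Longrightarrow> last (concat xs) = last (last xs)"
  by (cases xs rule: rev_cases) auto

lemma distinct_of_distinct_concat: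
  "distinct (concat xss) \<Longrightarrow> [] \<notin> set xss \<Longrightarrow> distinct xss"
  by (simp add: distinct_concat_iff removeAll_id)

lemma distinct_concat_same_set:
  assumes "distinct (concat xss)" and "distinct yss" and "set yss \<subseteq> set xss"
  shows "distinct (concat yss)"
  using assms unfolding distinct_concat_iff by (meson distinct_removeAll subsetD)

lemma dipath_concat:
  assumes "successively (\<lambda>s t. (last s, hd t) \<in> A) ss" and "\<And>s. s \<in> set ss \<Longrightarrow> dipath A s \<and> s \<noteq> []"
    and "distinct (concat ss)"
  shows "dipath A (concat ss)"
  using assms
proof (induction ss)
  case (Cons s ss)
  have "ss \<noteq> [] \<Longrightarrow> concat ss \<noteq> [] \<and> hd (concat ss) = hd (hd ss)"
    using Cons.prems(2) hd_concat_ne[of ss] by (cases ss) auto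
  then show ?case
    using Cons by (cases "ss = []") (auto simp: dipath_append_iff successively_Cons)
qed simp

text \<open>A composition seen through the map \<open>\<rho>\<close> from vertices to parts. Arcs
  between different parts are exactly those prescribed by \<open>E\<close>, while arcs inside a part
  are left open; this is all that remains of the digraphs substituted for the vertices.\<close>

locale semicomplete_composition =
  fixes E :: "'b rel" and P :: "'b set" and \<rho> :: "'a \<Rightarrow> 'b" and A :: "'a rel" and V :: "'a set"
  assumes blowup: "semicomplete_blowup E P"
    and card_P: "2 \<le> card P"
    and image_V: "\<rho> ` V = P"
    and arc_imp: "(x, y) \<in> A \<Longrightarrow> \<rho> x \<noteq> \<rho> y \<Longrightarrow> (\<rho> x, \<rho> y) \<in> E"
    and imp_arc: "x \<in> V \<Longrightarrow> y \<in> V \<Longrightarrow> (\<rho> x, \<rho> y) \<in> E \<Longrightarrow> (x, y) \<in> A"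
begin

text \<open>Contracting the maximal runs of the given paths inside the parts yields a blow-up of the
  underlying semicomplete digraph.\<close>

theorem strong_subdigraph_of_path_cover:
  assumes ps: "\<And>p. p \<in> set ps \<Longrightarrow> dipath A p \<and> p \<noteq> []" and dist: "distinct (concat ps)"
    and cover: "set (concat ps) = V"
  shows "\<exists>B. finite B \<and> B \<subseteq> A \<and> strong_on V B \<and> card B \<le> card V + length ps"
proof -
  define \<pi> where "\<pi> = (\<lambda>s. \<rho> (hd s) :: 'b)"
  interpret semicomplete_blowup E P \<pi> by (rule blowup)
  let ?R = "semicomplete_blowup.lift_arcs E \<pi>"
  have "\<exists>ss. ss \<noteq> [] \<and> concat ss = p \<and>
    (\<forall>s\<in>set ss. s \<noteq> [] \<and> dipath A s \<and> (\<forall>x\<in>set s. \<rho> x = \<rho> (hd s))) \<and>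
    successively (\<lambda>s t. (\<rho> (hd s), \<rho> (hd t)) \<in> E) ss" if "p \<in> set ps" for p
    using split_into_runs[of A p \<rho> E] ps[OF that] arc_imp by blast
  then obtain f where f: "\<And>p. p \<in> set ps \<Longrightarrow> f p \<noteq> [] \<and> concat (f p) = p \<and>
    (\<forall>s\<in>set (f p). s \<noteq> [] \<and> dipath A s \<and> (\<forall>x\<in>set s. \<rho> x = \<rho> (hd s))) \<and>
    successively (\<lambda>s t. (\<rho> (hd s), \<rho> (hd t)) \<in> E) (f p)"
    by metis
  define ls where "ls = map f ps"
  have concat_concat: "concat (concat ls) = concat ps"
  proof -
    have "concat (concat ls) = concat (map (\<lambda>p. concat (f p)) ps)"
      unfolding ls_def by (induction ps) auto
    also have "map (\<lambda>p. concat (f p)) ps = ps"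
      using f by (intro map_idI) auto
    finally show ?thesis .
  qed
  define S where "S = set (concat ls)"
  have S: "s \<noteq> [] \<and> dipath A s \<and> (\<forall>x\<in>set s. \<rho> x = \<pi> s)" if "s \<in> S" for s
    using that f unfolding S_def ls_def \<pi>_def by auto
  have ends: "hd s \<in> set s \<and> last s \<in> set s" if "s \<in> S" for s
    using S[OF that] by simp
  have US: "\<Union> (set ` S) = V"
    using cover concat_concat unfolding S_def by (metis set_concat)
  have dist_ls: "distinct (concat (concat ls))"
    using dist concat_concat by simp
  then have dist_ls': "distinct (concat ls)"
    using S unfolding S_def by (intro distinct_of_distinct_concat) auto
  \<comment> \<open>A run lies in a single part, so an arc between contracted runs stands for all
    arcs from one run to the other, in particular for the one that concatenation needs.\<close>
  have arc: "(last s, hd t) \<in> A" if "(s, t) \<in> ?R" "s \<in> S" "t \<in> S" for s t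
  proof -
    have "last s \<in> set s" "hd t \<in> set t" using S that by auto
    moreover have "last s \<in> V" "hd t \<in> V" using calculation that US by auto
    ultimately show ?thesis
      using imp_arc[of "last s" "hd t"] S that by (simp add: lift_arcs_iff)
  qed
  have expand: "dipath A (concat l)" if "dipath ?R l" "set l \<subseteq> S" for l
  proof (rule dipath_concat)
    show "successively (\<lambda>s t. (last s, hd t) \<in> A) l"
    proof (rule successively_mono)
      show "successively (\<lambda>s t. (s, t) \<in> ?R) l" using that(1) by (simp add: dipath_def)
    qed (use that(2) arc in blast)
    show "distinct (concat l)"
      using that unfolding S_def dipath_def by (intro distinct_concat_same_set[OF dist_ls]) simp_all
  qed (use that S in auto)
  have "\<exists>c rs. dicycle ?R c \<and> 2 \<le> length c \<and> \<pi> ` set c = P \<and> length rs \<le> length ls \<and>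
    (\<forall>r\<in>set rs. dipath ?R r \<and> r \<noteq> []) \<and>
    distinct (c @ concat rs) \<and> set (c @ concat rs) = set (concat ls)"
  proof (rule spanning_cycle_and_paths[OF _ dist_ls' _ card_P])
    fix l assume "l \<in> set ls"
    then obtain p where p: "p \<in> set ps" "l = f p" unfolding ls_def by auto
    have "distinct l"
      using dist_ls' \<open>l \<in> set ls\<close> by (auto simp: distinct_concat_iff)
    then show "dipath ?R l \<and> l \<noteq> []"
      using f[OF p(1)] p(2) unfolding dipath_def lift_arcs_iff unfolding \<pi>_def by simp
  next
    show "\<pi> ` set (concat ls) = P"
    proof -
      have "\<pi> ` S = \<rho> ` \<Union> (set ` S)"
      proof (intro subset_antisym subsetI)
        fix u assume "u \<in> \<pi> ` S"
        then obtain s where "s \<in> S" "u = \<pi> s" by blast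
        moreover have "hd s \<in> set s" using S \<open>s \<in> S\<close> by (meson hd_in_set)
        ultimately show "u \<in> \<rho> ` \<Union> (set ` S)" unfolding \<pi>_def by blast
      next
        fix u assume "u \<in> \<rho> ` \<Union> (set ` S)"
        then obtain s x where "s \<in> S" "x \<in> set s" "u = \<rho> x" by blast
        then show "u \<in> \<pi> ` S" using S by blast
      qed
      then show ?thesis using US image_V unfolding S_def by simp
    qed
  qed
  then obtain c rs where c: "dicycle ?R c" "2 \<le> length c" "\<pi> ` set c = P"
    and rs: "length rs \<le> length ls" "\<forall>r\<in>set rs. dipath ?R r \<and> r \<noteq> []"
    and dist_crs: "distinct (c @ concat rs)" and set_crs: "set (c @ concat rs) = S"
    unfolding S_def by blast
  have cS: "set c \<subseteq> S" and rsS: "\<And>r. r \<in> set rs \<Longrightarrow> set r \<subseteq> S"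
    using set_crs by auto
  have c_ne: "c \<noteq> []" using c(2) by auto
  have hl: "hd c \<in> S" "last c \<in> S" using c_ne cS by auto
  have ne: "hd c \<noteq> []" "last c \<noteq> []" using hl S by auto
  have concat_crs: "concat (c @ concat rs) = concat c @ concat (map concat rs)"
    by (induction rs) auto
  have dist_q: "distinct (concat c @ concat (map concat rs))"
    unfolding concat_crs[symmetric]
    by (rule distinct_concat_same_set[OF dist_ls dist_crs]) (use set_crs in \<open>simp only: S_def subset_refl\<close>)
  have set_q: "set (concat c @ concat (map concat rs)) = V"
    unfolding concat_crs[symmetric] using set_crs US by (metis set_concat)
  have "(last c, hd c) \<in> ?R" using c(1,2) by (simp add: dicycle_def)
  then have "(last (concat c), hd (concat c)) \<in> A"
    using arc[of "last c" "hd c"] hl hd_concat_ne[OF c_ne ne(1)] last_concat_ne[OF c_ne ne(2)] by simp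
  then have cq: "dicycle A (concat c)"
    using expand[OF dicycle_imp_dipath[OF c(1)] cS] c_ne ne by (auto simp: dicycle_def)
  have "length c \<le> length (concat c)"
    using cS S
  proof (induction c)
    case (Cons s c)
    then have "0 < length s" "length c \<le> length (concat c)" by auto
    moreover have "length (concat (s # c)) = length s + length (concat c)" by simp
    ultimately show ?case unfolding length_Cons by linarith
  qed simp
  then have len_q: "2 \<le> length (concat c)" using c(2) by simp
  have "\<exists>B. finite B \<and> B \<subseteq> A \<and> strong_on (set (concat c @ concat (map concat rs))) B \<and>
    card B \<le> card (set (concat c @ concat (map concat rs))) + length (map concat rs)"
  proof (rule strong_subdigraph_of_cycle_and_ears[OF cq len_q dist_q])
    fix q assume "q \<in> set (map concat rs)"
    then obtain r where r: "r \<in> set rs" "q = concat r" by auto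
    have r': "dipath ?R r" "r \<noteq> []" "set r \<subseteq> S" using rs r rsS by auto
    then have hlr: "hd r \<in> S" "last r \<in> S" by auto
    then have ner: "hd r \<noteq> []" "last r \<noteq> []" using S by auto
    have q: "hd q = hd (hd r)" "last q = last (last r)"
      using hd_concat_ne[OF r'(2) ner(1)] last_concat_ne[OF r'(2) ner(2)] r(2) by auto
    have inP: "\<pi> s \<in> \<pi> ` set c" if "s \<in> S" for s
    proof -
      have "hd s \<in> V" using S[OF that] US that by (metis UN_iff hd_in_set)
      then show ?thesis using image_V c(3) unfolding \<pi>_def by blast
    qed
    \<comment> \<open>The cycle contains a twin \<open>s\<close> of the run \<open>hd r\<close>. The
      predecessor of \<open>s\<close> on the cycle has an arc to \<open>hd r\<close> as well, and
      its last vertex is where the ear starts. The end of the ear is found in the same way from a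
      successor.\<close>
    obtain s where s: "s \<in> set c" "\<pi> s = \<pi> (hd r)" using inP[OF hlr(1)] by force
    obtain a where a: "a \<in> set c" "(a, s) \<in> ?R" using dicycle_pred[OF c(1) s(1) c(2)] by blast
    have "(last a, hd q) \<in> A" using arc[of a "hd r"] a s hlr cS q by (auto simp: lift_arcs_iff)
    moreover have "last a \<in> set (concat c)" using a(1) ends[of a] cS unfolding set_concat by blast
    moreover obtain t where t: "t \<in> set c" "\<pi> t = \<pi> (last r)" using inP[OF hlr(2)] by force
    obtain b where b: "b \<in> set c" "(t, b) \<in> ?R" using dicycle_succ[OF c(1) t(1) c(2)] by blast
    have "(last q, hd b) \<in> A" using arc[of "last r" b] b t hlr cS q by (auto simp: lift_arcs_iff)
    moreover have "hd b \<in> set (concat c)" using b(1) ends[of b] cS unfolding set_concat by blast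
    moreover have "dipath A q" using expand[OF r'(1,3)] r(2) by simp
    moreover have "q \<noteq> []" using r'(2) r(2) ner(1) by (cases r) auto
    ultimately show "dipath A q \<and> q \<noteq> [] \<and> (\<exists>a\<in>set (concat c). (a, hd q) \<in> A) \<and>
      (\<exists>b\<in>set (concat c). (last q, b) \<in> A)"
      by blast
  qed
  then show ?thesis
    using rs(1) unfolding set_q ls_def by auto
qed

end

section \<open>From a strong digraph to a path cover\<close>

lemma rtrancl_leaves:
  assumes "(u, v) \<in> A\<^sup>*" and "u \<in> W" and "v \<notin> W"
  shows "\<exists>x\<in>W. \<exists>y. y \<notin> W \<and> (x, y) \<in> A"
  using assms by (induction rule: converse_rtrancl_induct) auto

text \<open>The walk is stopped at its first vertex in \<open>W\<close> and shortened whenever it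
  would revisit its start. The clause on \<open>Domain A\<close> is what later places the path
  inside the vertex set.\<close>

lemma dipath_into:
  assumes "(v, w) \<in> A\<^sup>*" and "v \<notin> W" and "w \<in> W"
  shows "\<exists>r. r \<noteq> [] \<and> hd r = v \<and> dipath A r \<and> set r \<inter> W = {} \<and> set r \<subseteq> Domain A \<and>
    (\<exists>b\<in>W. (last r, b) \<in> A)"
  using assms
proof (induction rule: converse_rtrancl_induct)
  case (step v v')
  show ?case
  proof (cases "v' \<in> W")
    case True
    then show ?thesis using step by (intro exI[of _ "[v]"]) auto
  next
    case False
    then obtain r where r: "r \<noteq> []" "hd r = v'" "dipath A r" "set r \<inter> W = {}" "set r \<subseteq> Domain A"
      "\<exists>b\<in>W. (last r, b) \<in> A"
      using step.IH step.prems by blast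
    show ?thesis
    proof (cases "v \<in> set r")
      case True
      then obtain xs ys where "r = xs @ v # ys" by (meson split_list)
      then show ?thesis using r by (intro exI[of _ "v # ys"]) (auto simp: dipath_append_iff)
    next
      case False
      then show ?thesis
        using r step by (intro exI[of _ "v # r"]) (auto simp: dipath_Cons_iff)
    qed
  qed
qed simp

definition path_cover :: "'a rel \<Rightarrow> 'a set \<Rightarrow> 'a list list \<Rightarrow> bool" where
  "path_cover A V ps \<longleftrightarrow>
     (\<forall>p\<in>set ps. dipath A p \<and> p \<noteq> []) \<and> distinct (concat ps) \<and> set (concat ps) = V"

text \<open>\<open>W\<close> arises from a cycle by adding \<open>j\<close> ears, each having one more arc than new vertices.
  The cycle and its first ear together form a single path, hence \<open>j\<close> rather than \<open>j + 1\<close> paths.\<close>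

definition ear_built :: "'a rel \<Rightarrow> 'a set \<Rightarrow> nat \<Rightarrow> bool" where
  "ear_built A W j \<longleftrightarrow>
     (\<exists>B. B \<subseteq> A \<inter> W \<times> W \<and> card B = card W + j) \<and>
     (if j = 0 then \<exists>c. dicycle A c \<and> 2 \<le> length c \<and> set c = W
      else \<exists>ps. length ps = j \<and> path_cover A W ps)"

lemma ear_exists:
  assumes strong: "strong_on V A" and W: "W \<subseteq> V" "W \<noteq> {}" "W \<noteq> V" and A: "A \<subseteq> V \<times> V"
  shows "\<exists>a r b. a \<in> W \<and> b \<in> W \<and> r \<noteq> [] \<and> dipath A r \<and> set r \<inter> W = {} \<and> set r \<subseteq> V \<and>
    (a, hd r) \<in> A \<and> (last r, b) \<in> A"
proof -
  obtain u v where uv: "u \<in> W" "v \<in> V" "v \<notin> W" using W by blast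
  then have "(u, v) \<in> A\<^sup>*" using strong W unfolding strong_on_def by blast
  then obtain a y where ay: "a \<in> W" "y \<notin> W" "(a, y) \<in> A" using rtrancl_leaves uv by metis
  have "y \<in> V" "u \<in> V" using ay(3) A uv(1) W(1) by blast+
  then have "(y, u) \<in> A\<^sup>*" using strong unfolding strong_on_def by blast
  then obtain r b where "r \<noteq> []" "hd r = y" "dipath A r" "set r \<inter> W = {}" "set r \<subseteq> Domain A"
    "b \<in> W" "(last r, b) \<in> A"
    using dipath_into[of y u A W] ay(2) uv(1) by blast
  moreover have "Domain A \<subseteq> V" using A by blast
  ultimately show ?thesis using ay by blast
qed

lemma ear_built_add_ear:
  assumes built: "ear_built A W j" and fin: "finite W"
    and ab: "a \<in> W" "b \<in> W" and r: "r \<noteq> []" "dipath A r" "set r \<inter> W = {}"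
    and arcs: "(a, hd r) \<in> A" "(last r, b) \<in> A"
  shows "ear_built A (W \<union> set r) (Suc j)"
proof -
  obtain B where B: "B \<subseteq> A \<inter> W \<times> W" "card B = card W + j"
    using built unfolding ear_built_def by blast
  have "finite B" using B(1) fin by (meson finite_Int finite_SigmaI finite_subset)
  let ?B = "B \<union> ear_arcs a r b"
  have "distinct r" using r(2) by (simp add: dipath_def)
  then have "card (ear_arcs a r b) = card (set r) + 1"
    using card_ear_arcs[of a r b] ab r(3) by (auto simp: distinct_card)
  \<comment> \<open>Each arc of the ear has an end outside \<open>W\<close>, so no arc is counted
    twice and the cardinality is exact.\<close>
  moreover have "B \<inter> ear_arcs a r b = {}"
    using B(1) ear_arcs_outside[OF r(1,3), of a b] by blast
  ultimately have card: "card ?B = card (W \<union> set r) + Suc j"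
    using B(2) \<open>finite B\<close> fin r(3) by (simp add: card_Un_disjoint Int_commute)
  have sub: "?B \<subseteq> A \<inter> (W \<union> set r) \<times> (W \<union> set r)"
    using B(1) ear_arcs_subset[OF r(2,1) arcs] ear_arcs_verts[of a r b] ab by blast
  have "\<exists>ps. length ps = Suc j \<and> path_cover A (W \<union> set r) ps"
  proof (cases "j = 0")
    case True
    then obtain c where c: "dicycle A c" "set c = W"
      using built unfolding ear_built_def by auto
    \<comment> \<open>Opening the cycle behind \<open>a\<close> gives a path through all of
      \<open>W\<close> that ends where the ear begins. The first ear prolongs it, so one ear yields
      one path.\<close>
    have "a \<in> set c" using ab c by simp
    then obtain xs where xs: "dicycle A (xs @ [a])" "set (xs @ [a]) = set c"
      using dicycle_rotate_last[OF c(1)] by metis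
    have "set (xs @ [a]) \<inter> set r = {}"
      unfolding xs(2) c(2) using r(3) by blast
    then have "dipath A ((xs @ [a]) @ r)"
      unfolding dipath_append_iff[of A "xs @ [a]"]
      using dicycle_imp_dipath[OF xs(1)] r(2) arcs(1) by simp
    moreover have "set ((xs @ [a]) @ r) = W \<union> set r"
      using xs(2) c(2) by (metis set_append)
    ultimately have "path_cover A (W \<union> set r) [(xs @ [a]) @ r]"
      unfolding path_cover_def by (auto simp: dipath_def)
    then show ?thesis using True by (metis One_nat_def length_Cons list.size(3))
  next
    case False
    then obtain ps where "length ps = j" "path_cover A W ps"
      using built unfolding ear_built_def by auto
    then show ?thesis
      using r \<open>distinct r\<close> by (intro exI[of _ "r # ps"]) (auto simp: path_cover_def)
  qed
  moreover have "\<exists>B. B \<subseteq> A \<inter> (W \<union> set r) \<times> (W \<union> set r) \<and> card B = card (W \<union> set r) + Suc j"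
    using card sub by blast
  ultimately show ?thesis
    unfolding ear_built_def by (simp only: nat.distinct if_False simp_thms)
qed

text \<open>Each ear has at least one vertex outside \<open>W\<close>, so the number of missing
  vertices decreases.\<close>

lemma ear_built_spanning:
  assumes strong: "strong_on V A" and V: "finite V" and A: "A \<subseteq> V \<times> V"
    and "ear_built A W j" and "W \<subseteq> V" and "W \<noteq> {}"
  shows "\<exists>j. ear_built A V j"
  using assms(4-)
proof (induction "card (V - W)" arbitrary: W j rule: less_induct)
  case less
  show ?case
  proof (cases "W = V")
    case True
    then show ?thesis using less.prems by auto
  next
    case False
    obtain a r b where abr: "a \<in> W" "b \<in> W" "r \<noteq> []" "dipath A r" "set r \<inter> W = {}" "set r \<subseteq> V"
      "(a, hd r) \<in> A" "(last r, b) \<in> A"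
      using ear_exists[OF strong less.prems(2,3) False A] by blast
    have "finite W" using less.prems(2) V finite_subset by blast
    then have built: "ear_built A (W \<union> set r) (Suc j)"
      using ear_built_add_ear[OF less.prems(1)] abr by blast
    have "hd r \<in> set r" using abr(3) by simp
    then have "hd r \<in> V - W" using abr(5,6) by blast
    with \<open>hd r \<in> set r\<close> have "card (V - (W \<union> set r)) < card (V - W)"
      using V by (intro psubset_card_mono) auto
    then show ?thesis
      using less.hyps[OF _ built] abr less.prems by auto
  qed
qed

theorem strong_imp_ear_built:
  assumes strong: "strong_on V A" and A: "A \<subseteq> V \<times> V" and card: "2 \<le> card V"
  shows "\<exists>j. ear_built A V j"
proof -
  have V: "finite V" "V \<noteq> {}" using card by (auto intro: card_ge_0_finite)
  then obtain x where x: "x \<in> V" by blast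
  have "{x} \<noteq> V" using card by auto
  \<comment> \<open>An ear on a single vertex starts and ends there, so it is the initial cycle,
    with as many arcs as vertices.\<close>
  then obtain a r b where abr: "a \<in> {x}" "b \<in> {x}" "r \<noteq> []" "dipath A r" "set r \<inter> {x} = {}" "set r \<subseteq> V"
      "(a, hd r) \<in> A" "(last r, b) \<in> A"
    using ear_exists[OF strong _ _ _ A, of "{x}"] x by blast
  have "dicycle A (x # r)" "2 \<le> length (x # r)"
    using abr by (auto simp: dicycle_def dipath_Cons_iff Suc_le_eq)
  moreover have "card (ear_arcs x r x) = card (set (x # r))"
    using card_ear_arcs[of x r x] abr by (auto simp: dipath_def distinct_card card_insert_if)
  moreover have "ear_arcs x r x \<subseteq> A \<inter> set (x # r) \<times> set (x # r)"
    using ear_arcs_subset[OF abr(4,3), of x x] abr ear_arcs_verts[of x r x] by auto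
  ultimately have "ear_built A (set (x # r)) 0"
    unfolding ear_built_def by (metis add_0_right)
  then show ?thesis
    using ear_built_spanning[OF strong V(1) A] abr x by auto
qed

section \<open>Hamiltonicity of the extended digraphs\<close>

lemma pcas_zip: "pcas a (zip (a # r) (r @ [b])) b"
  by (induction r arbitrary: a) auto

lemma pawalk_verts_zip: "pawalk_verts u (zip (a # r) (r @ [b])) = a # r @ [b]"
  by (induction r arbitrary: a u) auto

text \<open>The heads of the arcs of a closed walk list its vertices without repeating the start,
  which appears once, as the last head. The argument \<open>w\<close> is free because it affects
  only the empty walk.\<close>

lemma pcas_verts:
  assumes "pcas u p v" and "set p \<subseteq> A" and "p \<noteq> []"
  shows "successively (\<lambda>x y. (x, y) \<in> A) (map snd p) \<and> last (map snd p) = v \<and>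
    (u, hd (map snd p)) \<in> A \<and> pawalk_verts w p = u # map snd p"
  using assms
proof (induction p arbitrary: u w)
  case (Cons e p)
  show ?case
  proof (cases "p = []")
    case True
    then show ?thesis using Cons.prems by (cases e) auto
  next
    case False
    then show ?thesis
      using Cons.IH[of "snd e" "snd e"] Cons.prems by (cases e) (auto simp: successively_Cons)
  qed
qed simp

text \<open>The bound on the length removes the trivial cycles that \<open>dicycle\<close> admits.
  Conversely, a cycle given by arcs satisfies it because a single closed arc would be a
  loop.\<close>

lemma hamiltonian_iff_dicycle:
  assumes "pair_loopfree_digraph G"
  shows "hamiltonian (with_proj G) \<longleftrightarrow>
    (\<exists>c. dicycle (parcs G) c \<and> 2 \<le> length c \<and> set c = pverts G)"
proof -
  interpret pair_loopfree_digraph G by (rule assms)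
  show ?thesis
  proof
    assume "hamiltonian (with_proj G)"
    then obtain w u p where p: "pcas u p u" "set p \<subseteq> parcs G" "p \<noteq> []"
      "distinct (tl (pawalk_verts u p))" "set (pawalk_verts w p) = pverts G"
      unfolding hamiltonian_def pre_digraph.cycle_def pre_digraph.awalk_def
      by (auto simp: cas_with_proj_eq awalk_verts_with_proj_eq)
    let ?c = "map snd p"
    have c: "successively (\<lambda>x y. (x, y) \<in> parcs G) ?c" "last ?c = u" "(u, hd ?c) \<in> parcs G"
      "pawalk_verts u p = u # ?c" "pawalk_verts w p = u # ?c"
      using pcas_verts[OF p(1-3)] by blast+
    have "u \<in> set ?c" using c(2) p(3) by (metis last_in_set map_is_Nil_conv)
    then have "set ?c = pverts G" using p(5) c(5) by auto
    moreover have "2 \<le> length ?c"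
    proof (rule ccontr)
      assume "\<not> 2 \<le> length ?c"
      then obtain e where "p = [e]" using p(3) by (cases p rule: list.exhaust; auto simp: Suc_le_eq)
      then have "(u, u) \<in> parcs G" using c by auto
      then show False using pair_no_loops by fastforce
    qed
    ultimately show "\<exists>c. dicycle (parcs G) c \<and> 2 \<le> length c \<and> set c = pverts G"
      using c p(3,4) by (intro exI[of _ ?c]) (auto simp: dicycle_def dipath_def)
  next
    assume "\<exists>c. dicycle (parcs G) c \<and> 2 \<le> length c \<and> set c = pverts G"
    then obtain c where c: "dicycle (parcs G) c" "2 \<le> length c" "set c = pverts G" by blast
    obtain x xs where xs: "c = x # xs" using c(2) by (cases c) auto
    then have ne: "xs \<noteq> []" using c(2) by auto
    let ?p = "zip (x # xs) (xs @ [x])"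
    have "set ?p \<subseteq> parcs G"
      using ear_arcs_subset[of "parcs G" xs x x] c xs ne unfolding ear_arcs_def
      by (auto simp: dicycle_def dipath_Cons_iff Suc_le_eq)
    moreover have "distinct (xs @ [x])" using c(1) xs by (auto simp: dicycle_def dipath_def)
    moreover have "x \<in> pverts G" "set (x # xs @ [x]) = pverts G" using c(3) xs by auto
    ultimately have "pre_digraph.cycle (with_proj G) ?p \<and>
      set (pre_digraph.awalk_verts (with_proj G) x ?p) = verts (with_proj G)"
      unfolding pre_digraph.cycle_def pre_digraph.awalk_def cas_with_proj_eq awalk_verts_with_proj_eq
        pawalk_verts_zip with_proj_simps
      by (intro conjI exI[of _ x] pcas_zip) (auto simp: ne)
    then show "hamiltonian (with_proj G)" unfolding hamiltonian_def by blast
  qed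
qed

section \<open>Structure of the extended digraphs\<close>

lemma H_ext_arcs [simp]:
  "(Old u, Old v) \<in> parcs (H_ext k D) \<longleftrightarrow> (u, v) \<in> parcs D"
  "(Old u, X i) \<in> parcs (H_ext k D) \<longleftrightarrow> u \<in> pverts D \<and> i \<in> {1..k}"
  "(Y i, Old v) \<in> parcs (H_ext k D) \<longleftrightarrow> v \<in> pverts D \<and> i \<in> {1..k}"
  "(X i, Y j) \<in> parcs (H_ext k D) \<longleftrightarrow> i \<in> {1..k} \<and> j \<in> {1..k}"
  "(Old u, Y i) \<notin> parcs (H_ext k D)" "(X i, Old u) \<notin> parcs (H_ext k D)"
  "(X i, X j) \<notin> parcs (H_ext k D)" "(Y i, Y j) \<notin> parcs (H_ext k D)"
  "(Y i, X j) \<notin> parcs (H_ext k D)"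
  by (auto simp: H_ext_def)

lemma H_ext_verts: "pverts (H_ext k D) = Old ` pverts D \<union> X ` {1..k} \<union> Y ` {1..k}"
  by (simp add: H_ext_def)

lemma loopfree_H_ext:
  assumes "pair_loopfree_digraph D"
  shows "pair_loopfree_digraph (H_ext k D)"
proof -
  interpret pair_loopfree_digraph D by (rule assms)
  show ?thesis
  proof
    show "fst e \<in> pverts (H_ext k D)" if "e \<in> parcs (H_ext k D)" for e
      using that arc_fst_in_verts unfolding H_ext_def by force
    show "snd e \<in> pverts (H_ext k D)" if "e \<in> parcs (H_ext k D)" for e
      using that arc_snd_in_verts unfolding H_ext_def by force
    show "fst e \<noteq> snd e" if "e \<in> parcs (H_ext k D)" for e
      using that pair_no_loops unfolding H_ext_def by force
  qed
qed

section \<open>A Hamiltonian cycle from a path cover\<close>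

fun join_paths :: "nat \<Rightarrow> 'a list list \<Rightarrow> 'a ext_vertex list" where
  "join_paths i [] = []"
| "join_paths i (p # ps) = map Old p @ X i # Y i # join_paths (Suc i) ps"

lemma dipath_map_Old: "dipath (parcs (H_ext k D)) (map Old p) \<longleftrightarrow> dipath (parcs D) p"
  by (auto simp: dipath_def successively_map distinct_map inj_on_def)

lemma set_join_paths:
  "set (join_paths i ps) =
     Old ` set (concat ps) \<union> X ` {i..<i + length ps} \<union> Y ` {i..<i + length ps}"
proof (induction ps arbitrary: i)
  case (Cons p ps)
  have "{i..<i + length (p # ps)} = insert i {Suc i..<Suc i + length ps}" by auto
  then show ?case using Cons by auto
qed simp

lemma last_join_paths: "ps \<noteq> [] \<Longrightarrow> last (join_paths i ps) = Y (i + length ps - 1)"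
proof (induction ps arbitrary: i)
  case (Cons p ps)
  then show ?case by (cases ps) auto
qed simp

lemma hd_join_paths: "ps \<noteq> [] \<Longrightarrow> hd ps \<noteq> [] \<Longrightarrow> hd (join_paths i ps) = Old (hd (hd ps))"
  by (cases ps) (auto simp: hd_map)

lemma dipath_join_paths:
  assumes "\<And>p. p \<in> set ps \<Longrightarrow> dipath (parcs D) p \<and> p \<noteq> []" and "distinct (concat ps)"
    and "set (concat ps) \<subseteq> pverts D" and "1 \<le> i" and "i + length ps \<le> Suc k"
  shows "dipath (parcs (H_ext k D)) (join_paths i ps)"
  using assms
proof (induction ps arbitrary: i)
  case (Cons p ps)
  let ?A = "parcs (H_ext k D)"
  have p: "dipath (parcs D) p" "p \<noteq> []" using Cons.prems(1) by auto
  have IH: "dipath ?A (join_paths (Suc i) ps)"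
    using Cons.IH[of "Suc i"] Cons.prems by auto
  have "(Y i, hd (join_paths (Suc i) ps)) \<in> ?A" if "ps \<noteq> []"
  proof -
    have "hd ps \<in> set ps" using that by simp
    then have "hd ps \<noteq> []" "set (hd ps) \<subseteq> pverts D" using Cons.prems(1,3) by auto
    then show ?thesis using hd_join_paths[OF that, of "Suc i"] Cons.prems(4,5) by auto
  qed
  moreover have "join_paths (Suc i) ps \<noteq> [] \<Longrightarrow> ps \<noteq> []" by auto
  moreover have "Y i \<notin> set (join_paths (Suc i) ps)" "X i \<notin> set (join_paths (Suc i) ps)"
    unfolding set_join_paths by auto
  ultimately have "dipath ?A (X i # Y i # join_paths (Suc i) ps)"
    using IH Cons.prems(4,5) by (auto simp: dipath_Cons_iff)
  moreover have "(Old (last p), X i) \<in> ?A"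
    using p(2) Cons.prems(3-5) by auto
  moreover have "set (map Old p) \<inter> set (X i # Y i # join_paths (Suc i) ps) = {}"
    using Cons.prems(2) by (auto simp: set_join_paths)
  ultimately show ?case
    using p by (auto simp: dipath_append_iff dipath_map_Old last_map)
qed simp

lemma hamiltonian_H_ext_of_path_cover:
  assumes "pair_loopfree_digraph D" and ps: "path_cover (parcs D) (pverts D) ps" and "ps \<noteq> []"
  shows "hamiltonian (with_proj (H_ext (length ps) D))"
proof -
  let ?c = "join_paths 1 ps"
  have path: "dipath (parcs (H_ext (length ps) D)) ?c"
    using ps unfolding path_cover_def by (intro dipath_join_paths) auto
  have "hd ps \<in> set ps" using assms(3) by simp
  then have hd: "hd ps \<noteq> []" "hd (hd ps) \<in> pverts D"
    using ps unfolding path_cover_def by (auto intro: hd_in_set)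
  have "(last ?c, hd ?c) \<in> parcs (H_ext (length ps) D)"
    unfolding last_join_paths[OF assms(3)] hd_join_paths[OF assms(3) hd(1)]
    using hd(2) assms(3) by (auto simp: Suc_le_eq)
  moreover have "2 \<le> length ?c" "?c \<noteq> []" using assms(3) by (cases ps; auto)+
  ultimately have "dicycle (parcs (H_ext (length ps) D)) ?c"
    using path by (simp add: dicycle_def)
  moreover have "set ?c = pverts (H_ext (length ps) D)"
    using ps unfolding set_join_paths H_ext_verts path_cover_def by auto
  ultimately show ?thesis
    using hamiltonian_iff_dicycle[OF loopfree_H_ext[OF assms(1)]] \<open>2 \<le> length ?c\<close> by blast
qed

section \<open>A path cover from a Hamiltonian cycle\<close>

fun old_vertices :: "'a ext_vertex list \<Rightarrow> 'a list" where
  "old_vertices [] = []"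
| "old_vertices (Old v # l) = v # old_vertices l"
| "old_vertices (X i # l) = old_vertices l"
| "old_vertices (Y i # l) = old_vertices l"

fun count_Y :: "'a ext_vertex list \<Rightarrow> nat" where
  "count_Y [] = 0"
| "count_Y (Old v # l) = count_Y l"
| "count_Y (X i # l) = count_Y l"
| "count_Y (Y i # l) = Suc (count_Y l)"

lemma set_old_vertices: "v \<in> set (old_vertices l) \<longleftrightarrow> Old v \<in> set l"
  by (induction l rule: old_vertices.induct) auto

lemma distinct_old_vertices: "distinct l \<Longrightarrow> distinct (old_vertices l)"
  by (induction l rule: old_vertices.induct) (auto simp: set_old_vertices)

lemma count_Y_eq: "distinct l \<Longrightarrow> count_Y l = card {i. Y i \<in> set l}"
proof (induction l rule: count_Y.induct)
  case (4 i l)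
  have "{j. Y j \<in> set (Y i # l)} = insert i {j. Y j \<in> set l}" by auto
  moreover have "finite {j. Y j \<in> set l}"
    by (rule finite_subset[of _ "(\<lambda>y. case y of Y j \<Rightarrow> j) ` set l"]) (auto intro: rev_image_eqI)
  ultimately show ?case using 4 by simp
qed auto

text \<open>Arcs into old vertices come only from old vertices and from vertices \<open>Y i\<close>.
  So every run of old vertices is preceded by its own \<open>Y i\<close>, except for a run at the
  very beginning, which the \<open>case\<close> term accounts for.\<close>

lemma paths_of_H_ext_dipath:
  assumes "dipath (parcs (H_ext k D)) l" and "l \<noteq> []"
  shows "\<exists>ps. (\<forall>p\<in>set ps. dipath (parcs D) p \<and> p \<noteq> []) \<and> concat ps = old_vertices l \<and>
    length ps \<le> count_Y l + (case hd l of Old v \<Rightarrow> 1 | _ \<Rightarrow> 0)"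
  using assms
proof (induction l)
  case (Cons x l)
  show ?case
  proof (cases "l = []")
    case True
    show ?thesis
    proof (cases x)
      case (Old v)
      then show ?thesis using True by (intro exI[of _ "[[v]]"]) auto
    qed (use True in \<open>auto intro!: exI[of _ "[]"]\<close>)
  next
    case False
    have "dipath (parcs (H_ext k D)) l" using Cons.prems(1) by (simp add: dipath_Cons_iff)
    then obtain ps where ps: "\<forall>p\<in>set ps. dipath (parcs D) p \<and> p \<noteq> []" "concat ps = old_vertices l"
      "length ps \<le> count_Y l + (case hd l of Old v \<Rightarrow> 1 | _ \<Rightarrow> 0)"
      using Cons.IH False by blast
    obtain y l' where l: "l = y # l'" using False by (cases l) auto
    have arc: "(x, y) \<in> parcs (H_ext k D)" and x: "x \<notin> set l"
      using Cons.prems l by (auto simp: dipath_Cons_iff)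
    show ?thesis
    proof (cases x)
      case (Old v)
      show ?thesis
      proof (cases y)
        case y: (Old w)
        \<comment> \<open>\<open>l\<close> starts with an old vertex, so the first path starts there
          too. Putting \<open>v\<close> in front of it changes neither the number of paths nor the
          bound.\<close>
        obtain p ps' where p: "ps = p # ps'" using ps(2) l y by (cases ps) auto
        then have "p \<noteq> []" using ps(1) by simp
        moreover have "hd p = w"
          using ps(2) l y p \<open>p \<noteq> []\<close> by (cases p) auto
        moreover have "v \<notin> set (concat ps)"
          using x Old ps(2) set_old_vertices[of v l] by simp
        then have "v \<notin> set p" using p by simp
        ultimately have "dipath (parcs D) (v # p)"
          using ps(1) p arc Old y by (auto simp: dipath_Cons_iff)
        then show ?thesis
          using ps p Old y l by (intro exI[of _ "(v # p) # ps'"]) auto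
      qed (use ps l arc Old in \<open>auto intro!: exI[of _ "[v] # ps"]\<close>)
    next
      case (X i)
      then show ?thesis using ps l arc by (cases y) (auto intro!: exI[of _ ps])
    next
      case (Y i)
      then show ?thesis using ps l arc by (cases y) (auto intro!: exI[of _ ps])
    qed
  qed
qed simp

lemma path_cover_of_hamiltonian_H_ext:
  assumes "pair_loopfree_digraph D" and ham: "hamiltonian (with_proj (H_ext k D))" and "0 < k"
  shows "\<exists>ps. path_cover (parcs D) (pverts D) ps \<and> length ps \<le> k"
proof -
  obtain c where c: "dicycle (parcs (H_ext k D)) c" "set c = pverts (H_ext k D)"
    using ham hamiltonian_iff_dicycle[OF loopfree_H_ext[OF assms(1)]] by blast
  \<comment> \<open>Starting the cycle at a vertex \<open>Y 1\<close>, available as \<open>k\<close>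
    is positive, makes the extra term for an initial run vanish; otherwise the bound would be
    \<open>k + 1\<close>.\<close>
  have "Y 1 \<in> set c" using c(2) \<open>0 < k\<close> by (auto simp: H_ext_verts)
  then obtain l where l: "dicycle (parcs (H_ext k D)) (Y 1 # l)" "set (Y 1 # l) = set c"
    using dicycle_rotate_hd[OF c(1)] by metis
  let ?l = "Y 1 # l"
  have dist: "distinct ?l" and path: "dipath (parcs (H_ext k D)) ?l"
    using l(1) by (auto simp: dicycle_def dipath_def)
  have sets: "set ?l = Old ` pverts D \<union> X ` {1..k} \<union> Y ` {1..k}"
    using l(2) c(2) by (simp only: H_ext_verts)
  obtain ps where ps: "\<forall>p\<in>set ps. dipath (parcs D) p \<and> p \<noteq> []" "concat ps = old_vertices ?l"
    "length ps \<le> count_Y ?l"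
    using paths_of_H_ext_dipath[OF path] by auto
  have "{i. Y i \<in> set ?l} = {1..k}" unfolding sets by auto
  then have "count_Y ?l = k" using count_Y_eq[OF dist] by simp
  moreover have "set (old_vertices ?l) = pverts D"
    by (rule set_eqI) (simp only: set_old_vertices sets, auto)
  moreover have "distinct (old_vertices ?l)" using distinct_old_vertices[OF dist] .
  ultimately show ?thesis
    using ps unfolding path_cover_def by metis
qed

lemma dicycle_of_hamiltonian_H_ext_0:
  assumes "pair_loopfree_digraph D" and "hamiltonian (with_proj (H_ext 0 D))"
  shows "\<exists>c. dicycle (parcs D) c \<and> 2 \<le> length c \<and> set c = pverts D"
proof -
  obtain c where c: "dicycle (parcs (H_ext 0 D)) c" "2 \<le> length c" "set c = Old ` pverts D"
    using assms(2) hamiltonian_iff_dicycle[OF loopfree_H_ext[OF assms(1)]] by (auto simp: H_ext_verts)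
  then obtain d where d: "c = map Old d" by (metis ex_map_conv imageE)
  have "d \<noteq> []" using c(2) d by auto
  then have "dicycle (parcs D) d"
    using c d by (auto simp: dicycle_def dipath_map_Old hd_map last_map)
  moreover have "set d = pverts D" using c(3) d by auto
  ultimately show ?thesis using c(2) d by auto
qed

lemma hamiltonian_H_ext_0:
  assumes "pair_loopfree_digraph D" and "dicycle (parcs D) c" "2 \<le> length c" "set c = pverts D"
  shows "hamiltonian (with_proj (H_ext 0 D))"
proof -
  have "c \<noteq> []" using assms(3) by auto
  then have "dicycle (parcs (H_ext 0 D)) (map Old c)"
    using assms(2) by (auto simp: dicycle_def dipath_map_Old hd_map last_map)
  moreover have "set (map Old c) = pverts (H_ext 0 D)" using assms(4) by (auto simp: H_ext_verts)
  moreover have "2 \<le> length (map Old c)" using assms(3) by simp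
  ultimately show ?thesis
    using hamiltonian_iff_dicycle[OF loopfree_H_ext[OF assms(1)]] by blast
qed

section \<open>Strong spanning subdigraphs of a composition\<close>

lemma strongly_connected_imp_strong_on:
  assumes "spanning S (with_proj Q)" and "strongly_connected S"
  shows "strong_on (pverts Q) (arcs S)" and "arcs S \<subseteq> parcs Q"
proof -
  have sub: "subgraph S (with_proj Q)" and verts: "verts S = pverts Q"
    using assms(1) by (auto simp: spanning_def)
  \<comment> \<open>A spanning subdigraph is an arbitrary digraph record here, but compatibility
    with \<open>Q\<close> forces its arcs to be pairs with the usual ends, so it can be treated as a
    set of arcs.\<close>
  then have "tail S = fst" "head S = snd" "wf_digraph S" and "arcs S \<subseteq> parcs Q"
    by (auto simp: subgraph_def compatible_def)
  then have "arcs_ends S = arcs S"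
    by (auto simp: arcs_ends_def arc_to_ends_def)
  moreover have "(u, v) \<in> (arcs_ends S)\<^sup>*" if "u \<rightarrow>\<^sup>*\<^bsub>S\<^esub> v" for u v
    using that unfolding reachable_def by (rule rtrancl_on_rtranclI)
  ultimately show "strong_on (pverts Q) (arcs S)"
    using assms(2) verts unfolding strongly_connected_def strong_on_def by auto
  show "arcs S \<subseteq> parcs Q" by fact
qed

lemma strong_on_imp_strongly_connected:
  assumes "pair_wf_digraph Q" and "B \<subseteq> parcs Q" and "strong_on (pverts Q) B" and "pverts Q \<noteq> {}"
  shows "\<exists>S. spanning S (with_proj Q) \<and> strongly_connected S \<and> arcs S = B"
proof -
  interpret Q: pair_wf_digraph Q by (rule assms(1))
  let ?S = "with_proj \<lparr>pverts = pverts Q, parcs = B\<rparr>"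
  have wf: "wf_digraph ?S"
    using assms(2) Q.wellformed' by unfold_locales auto
  then interpret S: wf_digraph ?S .
  have "spanning ?S (with_proj Q)"
    using assms(2) wf Q.wf_digraph_axioms by (auto simp: spanning_def subgraph_def compatible_def)
  moreover have "u \<rightarrow>\<^sup>*\<^bsub>?S\<^esub> v" if "u \<in> pverts Q" "v \<in> pverts Q" for u v
  proof -
    have "(u, v) \<in> (arcs_ends ?S)\<^sup>*"
      using assms(3) that by (simp add: strong_on_def)
    then show ?thesis
    proof (induction rule: rtrancl_induct)
      case base
      then show ?case using that by (intro S.reachable_refl) simp
    next
      case (step y z)
      then show ?case by (meson S.reachable_adj_trans)
    qed
  qed
  ultimately show ?thesis
    using assms(4) by (intro exI[of _ ?S]) (auto simp: strongly_connected_def)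
qed

section \<open>Compositions and their parts\<close>

lemma composition_is_pair_digraph:
  assumes T: "pair_digraph T" and H: "\<And>u. u \<in> pverts T \<Longrightarrow> pair_digraph (H u)"
    and disj: "disjoint_family_on (\<lambda>u. pverts (H u)) (pverts T)"
  shows "pair_digraph (composition T H)"
proof -
  let ?Q = "composition T H"
  interpret T: pair_digraph T by (rule T)
  have H': "fst e \<in> pverts (H u)" "snd e \<in> pverts (H u)" "fst e \<noteq> snd e"
    if "u \<in> pverts T" "e \<in> parcs (H u)" for u e
  proof -
    interpret Hu: pair_digraph "H u" using H that by blast
    show "fst e \<in> pverts (H u)" "snd e \<in> pverts (H u)" "fst e \<noteq> snd e"
      using that Hu.arc_fst_in_verts Hu.arc_snd_in_verts Hu.pair_no_loops by auto
  qed
  have arcs: "(\<exists>u\<in>pverts T. e \<in> parcs (H u)) \<or>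
    (\<exists>u w. (u, w) \<in> parcs T \<and> fst e \<in> pverts (H u) \<and> snd e \<in> pverts (H w))" if "e \<in> parcs ?Q" for e
    using that unfolding composition_def by auto
  have verts: "pverts ?Q = (\<Union>u\<in>pverts T. pverts (H u))"
    by (simp add: composition_def)
  have in_verts: "fst e \<in> pverts ?Q \<and> snd e \<in> pverts ?Q" if "e \<in> parcs ?Q" for e
    using arcs[OF that] H' T.wellformed' unfolding verts by (meson UN_I)
  have fin: "finite (pverts ?Q)"
  proof -
    have "finite (pverts (H u))" if "u \<in> pverts T" for u
      using H[OF that] pair_digraph.axioms(1) pair_fin_digraph.pair_finite_verts by blast
    then show ?thesis unfolding verts using T.pair_finite_verts by blast
  qed
  have "finite (parcs ?Q)"
    by (rule finite_subset[of _ "pverts ?Q \<times> pverts ?Q"]) (use in_verts fin in force)+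
  moreover have "fst e \<noteq> snd e" if "e \<in> parcs ?Q" for e
    using arcs[OF that]
  proof
    assume "\<exists>u w. (u, w) \<in> parcs T \<and> fst e \<in> pverts (H u) \<and> snd e \<in> pverts (H w)"
    then obtain u w where uw: "(u, w) \<in> parcs T" "fst e \<in> pverts (H u)" "snd e \<in> pverts (H w)"
      by blast
    \<comment> \<open>Since \<open>T\<close> has no loops, an arc between parts joins two disjoint
      vertex sets and is not a loop either.\<close>
    moreover have "u \<noteq> w" using T.pair_no_loops[OF uw(1)] by simp
    ultimately show ?thesis
      using disj T.wellformed'[OF uw(1)] unfolding disjoint_family_on_def by fastforce
  qed (use H' in blast)
  ultimately show ?thesis
    using in_verts fin by unfold_locales auto
qed

lemma semicomplete_composition_composition:
  assumes T: "pair_digraph T" and card: "2 \<le> card (pverts T)" and semi: "semicomplete T"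
    and H: "\<And>u. u \<in> pverts T \<Longrightarrow> pair_digraph (H u)"
    and ne: "\<And>u. u \<in> pverts T \<Longrightarrow> pverts (H u) \<noteq> {}"
    and disj: "disjoint_family_on (\<lambda>u. pverts (H u)) (pverts T)"
    and strong: "strong_on (pverts (composition T H)) (parcs (composition T H))"
  shows "\<exists>\<rho>. semicomplete_composition (parcs T) (pverts T) \<rho>
    (parcs (composition T H)) (pverts (composition T H))"
proof -
  let ?Q = "composition T H"
  interpret T: pair_digraph T by (rule T)
  have verts: "pverts ?Q = (\<Union>u\<in>pverts T. pverts (H u))"
    by (simp add: composition_def)
  then have "\<forall>x\<in>pverts ?Q. \<exists>u. u \<in> pverts T \<and> x \<in> pverts (H u)" by blast
  then obtain \<rho> where \<rho>: "\<And>x. x \<in> pverts ?Q \<Longrightarrow> \<rho> x \<in> pverts T \<and> x \<in> pverts (H (\<rho> x))"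
    by metis
  have \<rho>_eq: "\<rho> x = u" if "u \<in> pverts T" "x \<in> pverts (H u)" for x u
  proof -
    have "x \<in> pverts ?Q" using that verts by blast
    then show ?thesis using \<rho>[of x] that disj unfolding disjoint_family_on_def by blast
  qed
  have arc_imp: "(\<rho> x, \<rho> y) \<in> parcs T" if "(x, y) \<in> parcs ?Q" "\<rho> x \<noteq> \<rho> y" for x y
  proof -
    consider u where "u \<in> pverts T" "(x, y) \<in> parcs (H u)"
      | u w where "(u, w) \<in> parcs T" "x \<in> pverts (H u)" "y \<in> pverts (H w)"
      using \<open>(x, y) \<in> parcs ?Q\<close> unfolding composition_def by auto
    then show ?thesis
    proof cases
      case 1
      interpret Hu: pair_digraph "H u" using H 1 by blast
      have "\<rho> x = u" "\<rho> y = u" using \<rho>_eq 1 Hu.wellformed' by blast+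
      then show ?thesis using that by simp
    next
      case 2
      then show ?thesis using \<rho>_eq T.wellformed'[OF 2(1)] by metis
    qed
  qed
  have image: "\<rho> ` pverts ?Q = pverts T"
  proof
    show "pverts T \<subseteq> \<rho> ` pverts ?Q"
    proof
      fix u assume u: "u \<in> pverts T"
      then obtain x where "x \<in> pverts (H u)" using ne by blast
      then show "u \<in> \<rho> ` pverts ?Q" using u \<rho>_eq verts by blast
    qed
  qed (use \<rho> in blast)
  have "\<exists>u\<in>U. \<exists>v\<in>pverts T - U. (u, v) \<in> parcs T"
    if U: "U \<subseteq> pverts T" "U \<noteq> {}" "U \<noteq> pverts T" for U
  proof -
    obtain u v where uv: "u \<in> U" "v \<in> pverts T" "v \<notin> U" using U by blast
    have "u \<in> \<rho> ` pverts ?Q" "v \<in> \<rho> ` pverts ?Q" using image uv U(1) by blast+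
    then obtain x y where xy: "x \<in> pverts ?Q" "\<rho> x = u" "y \<in> pverts ?Q" "\<rho> y = v" by blast
    \<comment> \<open>Strength descends from the composition to \<open>T\<close>: a walk from
      \<open>x\<close> to \<open>y\<close> leaves the preimage of \<open>U\<close>, and the arc on
      which it does so joins different parts, hence comes from an arc of \<open>T\<close> that
      leaves \<open>U\<close>.\<close>
    then have "(x, y) \<in> (parcs ?Q)\<^sup>*" using strong unfolding strong_on_def by blast
    then have "\<exists>x'\<in>\<rho> -` U. \<exists>y'. y' \<notin> \<rho> -` U \<and> (x', y') \<in> parcs ?Q"
      by (rule rtrancl_leaves) (use xy uv in simp_all)
    then obtain x' y' where x'y': "\<rho> x' \<in> U" "\<rho> y' \<notin> U" "(x', y') \<in> parcs ?Q"
      by blast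
    then have "(\<rho> x', \<rho> y') \<in> parcs T" using arc_imp[of x' y'] by fastforce
    then show ?thesis using x'y' T.wellformed'(2) by blast
  qed
  moreover have "(u, u) \<notin> parcs T" for u
    using T.pair_no_loops by fastforce
  ultimately have "semicomplete_blowup (parcs T) (pverts T)"
    using semi unfolding semicomplete_def by unfold_locales blast+
  moreover have "(x, y) \<in> parcs ?Q"
    if "x \<in> pverts ?Q" "y \<in> pverts ?Q" "(\<rho> x, \<rho> y) \<in> parcs T" for x y
    using \<rho>[OF that(1)] \<rho>[OF that(2)] that(3) unfolding composition_def by auto
  ultimately show ?thesis
    using card image arc_imp by (intro exI[of _ \<rho>]) (simp add: semicomplete_composition_def)
qed

text \<open>Cycles and path covers of a subdigraph are also cycles and path covers of
  \<open>D\<close>. This turns the number of ears of a strong spanning subdigraph into an upper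
  bound for \<open>epsilon\<close>.\<close>

lemma hamiltonian_H_ext_of_ear_built:
  assumes D: "pair_loopfree_digraph D" and sub: "A \<subseteq> parcs D" and built: "ear_built A (pverts D) j"
  shows "hamiltonian (with_proj (H_ext j D))"
proof (cases "j = 0")
  case True
  then obtain c where "dicycle A c" "2 \<le> length c" "set c = pverts D"
    using built unfolding ear_built_def by auto
  moreover then have "dicycle (parcs D) c"
    using sub dipath_mono[OF _ sub] unfolding dicycle_def by blast
  ultimately show ?thesis using hamiltonian_H_ext_0[OF D] True by blast
next
  case False
  then obtain ps where ps: "length ps = j" "path_cover A (pverts D) ps"
    using built unfolding ear_built_def by auto
  then have "path_cover (parcs D) (pverts D) ps"
    using dipath_mono[OF _ sub] unfolding path_cover_def by blast
  then show ?thesis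
    using hamiltonian_H_ext_of_path_cover[OF D] ps(1) False by fastforce
qed

theorem theorem5p8:
  fixes T :: "'b pair_pre_digraph"
    and H :: "'b \<Rightarrow> 'a pair_pre_digraph"
    and Q :: "'a pair_pre_digraph"
    and n :: nat
  assumes "pair_digraph T"
    and "card (pverts T) \<ge> 2"
    and "semicomplete T"
    and "\<And>u. u \<in> pverts T \<Longrightarrow> pair_digraph (H u)"
    and "\<And>u. u \<in> pverts T \<Longrightarrow> pverts (H u) \<noteq> {}"
    and "disjoint_family_on (\<lambda>u. pverts (H u)) (pverts T)"
    and "Q = composition T H"
    and "strongly_connected (with_proj Q)"
    and "n = card (pverts Q)"
  shows "(\<exists>S. smallest_strong_spanning_subdigraph S (with_proj Q)) \<and>
         (\<forall>S. smallest_strong_spanning_subdigraph S (with_proj Q) \<longrightarrow>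
              card (arcs S) = n + epsilon Q)"
proof -
  have Q: "pair_digraph Q"
    using composition_is_pair_digraph[OF assms(1,4,6)] assms(7) by simp
  interpret Q: pair_digraph Q by (rule Q)
  have wf: "pair_wf_digraph Q" and lf: "pair_loopfree_digraph Q"
    by unfold_locales
  have spanning_Q: "spanning (with_proj Q) (with_proj Q)"
    using Q.wf_digraph_axioms by (auto simp: spanning_def subgraph_def compatible_def)
  have strong_Q: "strong_on (pverts Q) (parcs Q)"
    using strongly_connected_imp_strong_on(1)[OF spanning_Q assms(8)] by simp
  obtain \<rho> where comp: "semicomplete_composition (parcs T) (pverts T) \<rho> (parcs Q) (pverts Q)"
    using semicomplete_composition_composition[OF assms(1-6)] strong_Q assms(7) by blast
  interpret C: semicomplete_composition "parcs T" "pverts T" \<rho> "parcs Q" "pverts Q"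
    by (rule comp)
  have card_Q: "2 \<le> card (pverts Q)"
    using C.card_P C.image_V card_image_le[OF Q.pair_finite_verts, of \<rho>] by simp
  have parcs_sub: "parcs Q \<subseteq> pverts Q \<times> pverts Q"
    using Q.wellformed' by auto
  have lower: "hamiltonian (with_proj (H_ext (epsilon Q) Q)) \<and> n + epsilon Q \<le> card (arcs S)"
    if S: "spanning S (with_proj Q)" "strongly_connected S" for S
  proof -
    have sub: "arcs S \<subseteq> parcs Q"
      using strongly_connected_imp_strong_on(2)[OF S] .
    obtain j where j: "ear_built (arcs S) (pverts Q) j"
      using strong_imp_ear_built[OF strongly_connected_imp_strong_on(1)[OF S] _ card_Q] sub parcs_sub
      by blast
    have ham: "hamiltonian (with_proj (H_ext j Q))"
      using hamiltonian_H_ext_of_ear_built[OF lf sub j] .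
    obtain B where "B \<subseteq> arcs S" "card B = n + j"
      using j assms(9) unfolding ear_built_def by blast
    then have "n + j \<le> card (arcs S)"
      using sub Q.pair_finite_arcs by (metis card_mono finite_subset)
    moreover have "epsilon Q \<le> j"
      unfolding epsilon_def using ham by (rule Least_le)
    \<comment> \<open>The \<open>LEAST\<close> in \<open>epsilon\<close> is attained because
      \<open>j\<close> is a witness.\<close>
    moreover have "hamiltonian (with_proj (H_ext (epsilon Q) Q))"
      unfolding epsilon_def using ham by (rule LeastI)
    ultimately show ?thesis by simp
  qed
  \<comment> \<open>\<open>Q\<close> is a strong spanning subdigraph of itself, which already shows
    that the minimum defining \<open>epsilon Q\<close> exists.\<close>
  have ham: "hamiltonian (with_proj (H_ext (epsilon Q) Q))"
    using lower[OF spanning_Q assms(8)] by blast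
  have "\<exists>B. finite B \<and> B \<subseteq> parcs Q \<and> strong_on (pverts Q) B \<and> card B \<le> card (pverts Q) + epsilon Q"
  \<comment> \<open>A Hamiltonian cycle does not correspond to a cover by zero paths, so this case
    stands apart: the cycle without ears is the strong subdigraph sought.\<close>
  proof (cases "epsilon Q = 0")
    case True
    obtain c where c: "dicycle (parcs Q) c" "2 \<le> length c" "set c = pverts Q"
      using dicycle_of_hamiltonian_H_ext_0[OF lf] ham True by auto
    have "distinct c" using c(1) by (simp add: dicycle_def dipath_def)
    then show ?thesis
      using strong_subdigraph_of_cycle_and_ears[OF c(1,2), of "[]"] c(3) by auto
  next
    case False
    then obtain ps where ps: "path_cover (parcs Q) (pverts Q) ps" "length ps \<le> epsilon Q"
      using path_cover_of_hamiltonian_H_ext[OF lf ham] by blast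
    then obtain B where "finite B" "B \<subseteq> parcs Q" "strong_on (pverts Q) B"
      "card B \<le> card (pverts Q) + length ps"
      using C.strong_subdigraph_of_path_cover[of ps] unfolding path_cover_def by blast
    with ps(2) show ?thesis by (meson add_le_cancel_left order_trans)
  qed
  then obtain B where B: "B \<subseteq> parcs Q" "strong_on (pverts Q) B" "card B \<le> n + epsilon Q"
    using assms(9) by blast
  have "pverts Q \<noteq> {}" using card_Q by auto
  then obtain S0 where S0: "spanning S0 (with_proj Q)" "strongly_connected S0" "arcs S0 = B"
    using strong_on_imp_strongly_connected[OF wf B(1,2)] by blast
  \<comment> \<open>The construction gives only an upper bound on the arcs; the general lower bound
    makes it an equality and shows that \<open>S0\<close> is smallest.\<close>
  have card_S0: "card (arcs S0) = n + epsilon Q"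
    using lower[OF S0(1,2)] B(3) S0(3) by simp
  show ?thesis
  proof (intro conjI allI impI)
    show "\<exists>S. smallest_strong_spanning_subdigraph S (with_proj Q)"
      unfolding smallest_strong_spanning_subdigraph_def
      using S0(1,2) card_S0 lower by (intro exI[of _ S0]) auto
  next
    fix S assume S: "smallest_strong_spanning_subdigraph S (with_proj Q)"
    then have "card (arcs S) \<le> n + epsilon Q"
      using S0(1,2) card_S0 unfolding smallest_strong_spanning_subdigraph_def by metis
    moreover have "n + epsilon Q \<le> card (arcs S)"
      using S lower unfolding smallest_strong_spanning_subdigraph_def by blast
    ultimately show "card (arcs S) = n + epsilon Q" by simp
  qed
qed

end
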